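(* Let $n \in \mathbf{N}$, $0 < \alpha \leq \infty$, let $f\colon[0,\alpha)\to\mathbf{R}$ be continuous, and let $g(t) = f(t)/t$ for $t\in(0,\alpha)$. The following two assertions are equivalent: (ii) for each positive semidefinite matrix $a \in M_n$ with spectrum in $[0,\alpha)$ and each contraction $c \in M_n$, $$f(c^* a c) \leq c^* f(a) c;$$ (iii) $g$ is $n$-monotone in the interval $(0,\alpha)$.
   Context: $M_n$ is the algebra of complex $n\times n$ matrices, $\leq$ is the Loewner order on selfadjoint matrices, and $f(a)$ is defined by functional calculus; a contraction is a matrix $c$ with $c^*c\leq 1$. A function $g\colon I\to\mathbf{R}$ on an interval $I$ is $n$-monotone if $g(a)\leq g(b)$ for every pair of selfadjoint $a,b\in M_n$ with $a\leq b$ and all eigenvalues of $a$ and $b$ contained in $I$. *)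

theory Defs
  imports
    "HOL-Library.Extended_Real"
    "Jordan_Normal_Form.Schur_Decomposition"
    "Jordan_Normal_Form.Spectral_Radius"
begin

definition selfadjoint_mat :: "nat \<Rightarrow> complex mat \<Rightarrow> bool" where
  "selfadjoint_mat n a \<longleftrightarrow> a \<in> carrier_mat n n \<and> mat_adjoint a = a"

definition unitary_mat :: "nat \<Rightarrow> complex mat \<Rightarrow> bool" where
  "unitary_mat n u \<longleftrightarrow>
     u \<in> carrier_mat n n \<and> mat_adjoint u * u = 1\<^sub>m n \<and> u * mat_adjoint u = 1\<^sub>m n"

(* The order on complex numbers is that of Complex_Order: 0 \<le> z means that z is real and
   nonnegative. *)
definition psd_mat :: "nat \<Rightarrow> complex mat \<Rightarrow> bool" where
  "psd_mat n a \<longleftrightarrow> selfadjoint_mat n a \<and> (\<forall>v\<in>carrier_vec n. 0 \<le> (a *\<^sub>v v) \<bullet>c v)"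

definition loewner_le :: "nat \<Rightarrow> complex mat \<Rightarrow> complex mat \<Rightarrow> bool" where
  "loewner_le n a b \<longleftrightarrow> selfadjoint_mat n a \<and> selfadjoint_mat n b \<and> psd_mat n (b - a)"

definition contraction_mat :: "nat \<Rightarrow> complex mat \<Rightarrow> bool" where
  "contraction_mat n c \<longleftrightarrow> c \<in> carrier_mat n n \<and> loewner_le n (mat_adjoint c * c) (1\<^sub>m n)"

(* Spectra are sets of complex numbers, so a set of reals is embedded before comparing. *)
definition spectrum_in :: "complex mat \<Rightarrow> real set \<Rightarrow> bool" where
  "spectrum_in a I \<longleftrightarrow> spectrum a \<subseteq> complex_of_real ` I"

(* Functional calculus: if a = u diag(d) u^* with u unitary and d real, then
   f(a) = u diag(f o d) u^*.  For selfadjoint a such u and d exist by the spectral theorem;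
   the lemma functional_calculus_unique shows that f(a) does not depend on them.  Only the
   values of f on the spectrum of a matter.  For other matrices the result is unspecified. *)
definition diagonalizes :: "nat \<Rightarrow> complex mat \<Rightarrow> (nat \<Rightarrow> real) \<Rightarrow> complex mat \<Rightarrow> bool" where
  "diagonalizes n u d a \<longleftrightarrow>
     unitary_mat n u \<and> a = u * mat_diag n (\<lambda>i. complex_of_real (d i)) * mat_adjoint u"

definition functional_calculus :: "nat \<Rightarrow> (real \<Rightarrow> real) \<Rightarrow> complex mat \<Rightarrow> complex mat" where
  "functional_calculus n f a = (THE b. \<exists>u d. diagonalizes n u d a \<and> diagonalizes n u (f \<circ> d) b)"

definition n_monotone :: "nat \<Rightarrow> real set \<Rightarrow> (real \<Rightarrow> real) \<Rightarrow> bool" where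
  "n_monotone n I g \<longleftrightarrow>
     (\<forall>a b. selfadjoint_mat n a \<longrightarrow> selfadjoint_mat n b \<longrightarrow> loewner_le n a b \<longrightarrow>
        spectrum_in a I \<longrightarrow> spectrum_in b I \<longrightarrow>
        loewner_le n (functional_calculus n g a) (functional_calculus n g b))"

lemma functional_calculus_unique:
  assumes 1: "diagonalizes n u d a" "diagonalizes n u (f \<circ> d) b"
    and 2: "diagonalizes n v e a" "diagonalizes n v (f \<circ> e) b'"
  shows "b = b'"
proof -
  define D where "D d = mat_diag n (\<lambda>i. complex_of_real (d i))" for d :: "nat \<Rightarrow> real"
  define U where "U = mat_adjoint u"
  define V where "V = mat_adjoint v"
  define w where "w = V * u"
  have adj: "mat_adjoint x \<in> carrier_mat n n" if "x \<in> carrier_mat n n" for x :: "complex mat"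
    using that by (auto simp: mat_adjoint_def)
  have u: "u \<in> carrier_mat n n" "U * u = 1\<^sub>m n" "u * U = 1\<^sub>m n"
    and v: "v \<in> carrier_mat n n" "V * v = 1\<^sub>m n" "v * V = 1\<^sub>m n"
    using 1 2 by (auto simp: diagonalizes_def unitary_mat_def U_def V_def)
  have U: "U \<in> carrier_mat n n" and V: "V \<in> carrier_mat n n"
    using adj u(1) v(1) by (auto simp: U_def V_def)
  have D: "D d \<in> carrier_mat n n" for d by (simp add: D_def)
  have w: "w \<in> carrier_mat n n" using V u by (simp add: w_def)
  have entries: "(w * D p) $$ (i, j) = w $$ (i, j) * complex_of_real (p j)"
    "(D q * w) $$ (i, j) = complex_of_real (q i) * w $$ (i, j)"
    if "i < n" "j < n" for p q i j
    using that w by (simp_all add: D_def mat_diag_mult_left[OF w] mat_diag_mult_right[OF w])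
  note mult = mult_carrier_mat[where nr = n and n = n and nc = n]
  note assoc = assoc_mult_mat[where n\<^sub>1 = n and n\<^sub>2 = n and n\<^sub>3 = n and n\<^sub>4 = n]
  note one = left_mult_one_mat[where nr = n and nc = n] right_mult_one_mat[where nr = n and nc = n]
  note C = u(1) v(1) U V w D mult
  have a: "a = u * D d * U" "a = v * D e * V"
    and b: "b = u * D (f \<circ> d) * U" "b' = v * D (f \<circ> e) * V"
    using 1 2 by (auto simp: diagonalizes_def D_def U_def V_def)
  have "w * D d = V * (u * D d * (U * u))"
    by (simp add: w_def assoc one C u(2))
  also have "\<dots> = V * a * u"
    by (simp add: a(1) assoc C)
  also have "\<dots> = (V * v) * D e * w"
    by (simp add: a(2) w_def assoc C)
  finally have eq: "w * D d = D e * w"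
    by (simp add: v(2) one C)
  have eqf: "w * D (f \<circ> d) = D (f \<circ> e) * w"
  proof (rule eq_matI)
    fix i j assume "i < dim_row (D (f \<circ> e) * w)" "j < dim_col (D (f \<circ> e) * w)"
    then have ij: "i < n" "j < n" using w D[of "f \<circ> e"] by auto
    have "w $$ (i, j) = 0 \<or> d j = e i"
      using arg_cong[OF eq, of "\<lambda>m. m $$ (i, j)"] entries[OF ij] by auto
    then show "(w * D (f \<circ> d)) $$ (i, j) = (D (f \<circ> e) * w) $$ (i, j)"
      using entries[OF ij] by auto
  qed (use w D[of "f \<circ> d"] D[of "f \<circ> e"] in auto)
  have "b = (v * V) * b"
    unfolding v(3) by (simp add: b(1) one C)
  also have "\<dots> = v * (w * D (f \<circ> d)) * U"
    by (simp add: b(1) w_def assoc C)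
  also have "\<dots> = v * D (f \<circ> e) * V * (u * U)"
    unfolding eqf by (simp add: w_def assoc C)
  also have "\<dots> = b'"
    unfolding u(3) by (simp add: b(2) one C)
  finally show ?thesis .
qed

lemma functional_calculus_eq:
  assumes "diagonalizes n u d a"
  shows "functional_calculus n f a =
    u * mat_diag n (\<lambda>i. complex_of_real (f (d i))) * mat_adjoint u"
proof -
  let ?b = "u * mat_diag n (\<lambda>i. complex_of_real (f (d i))) * mat_adjoint u"
  have "diagonalizes n u (f \<circ> d) ?b"
    using assms by (auto simp: diagonalizes_def)
  with assms show ?thesis
    unfolding functional_calculus_def
    by (intro the_equality) (blast intro: functional_calculus_unique)+
qed

end

theory Submission
  imports "HOL-Analysis.Weierstrass_Theorems" Defs
begin

text \<open>
  A contraction inequality for \<open>f\<close> gives monotonicity of \<open>g\<close>: if \<open>0 < a \<le> b\<close>, then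
  \<open>c = b\<^sup>-\<^sup>1\<^sup>/\<^sup>2 a\<^sup>1\<^sup>/\<^sup>2\<close> is a contraction with \<open>c\<^sup>* b c = a\<close>, and conjugating the inequality by
  \<open>a\<^sup>-\<^sup>1\<^sup>/\<^sup>2\<close> yields \<open>g(a) \<le> g(b)\<close>. Conversely, \<open>x = a\<^sup>1\<^sup>/\<^sup>2 c\<close> satisfies \<open>x x\<^sup>* \<le> a\<close>, and
  \<open>x\<^sup>* g(x x\<^sup>*) x = f(x\<^sup>* x) = f(c\<^sup>* a c)\<close>; shifting \<open>g\<close> slightly to the right avoids inverting
  \<open>c\<close>, and \<open>f 0 \<le> 0\<close> absorbs the error in the limit. Singular \<open>a\<close> are approximated by \<open>a + s\<close>.
\<close>

text \<open>The obstacle is the point 0, where \<open>g\<close> has no value although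
  \<open>x x\<^sup>*\<close> and \<open>c\<^sup>* a c\<close> may be singular. Moving a function
  past \<open>x\<close> needs no inverse, so the shifted argument works for every \<open>c\<close>;
  it produces the functions t g(t + s), which tend to f(t) for t > 0 but vanish at t = 0. This wrong
  value at 0 is harmless on the smaller side, as f(0) <= 0, and harmful on the larger side. That
  asymmetry is why \<open>a\<close> is positive definite in the first limit while \<open>c\<close>
  stays arbitrary, and why singular \<open>a\<close> need a second limit. Both directions use that
  adjoints of contractions are contractions: in each, one of the products \<open>c\<^sup>* c\<close>
  and \<open>c c\<^sup>*\<close> is easily bounded and the other one is wanted.\<close>

no_notation vec_nth (infixl \<open>$\<close> 90)
no_notation inner (infix \<open>\<bullet>\<close> 70)

section \<open>Adjoints, unitary matrices and conjugated real diagonal matrices\<close>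

lemma mat_adjoint_dim [simp]:
  "dim_row (mat_adjoint A) = dim_col A" "dim_col (mat_adjoint A) = dim_row A"
  by (simp_all add: mat_adjoint_def)

lemma mat_adjoint_carrier [simp, intro]:
  "A \<in> carrier_mat n m \<Longrightarrow> mat_adjoint A \<in> carrier_mat m n"
  by (intro carrier_matI) simp_all

lemma mat_adjoint_index [simp]:
  fixes A :: "complex mat"
  assumes "i < dim_col A" "j < dim_row A"
  shows "mat_adjoint A $$ (i, j) = cnj (A $$ (j, i))"
  using assms by (simp add: mat_adjoint_def mat_of_rows_index)

lemma mat_adjoint_adjoint [simp]: "mat_adjoint (mat_adjoint A) = (A :: complex mat)"
  by (rule eq_matI) auto

lemma mat_adjoint_mult:
  fixes A B :: "complex mat"
  assumes "A \<in> carrier_mat n m" "B \<in> carrier_mat m l"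
  shows "mat_adjoint (A * B) = mat_adjoint B * mat_adjoint A"
  using assms
  by (intro eq_matI) (auto simp: scalar_prod_def mult.commute intro!: sum.cong)

lemma mat_adjoint_diag [simp]:
  "mat_adjoint (mat_diag n (\<lambda>i. complex_of_real (d i))) = mat_diag n (\<lambda>i. complex_of_real (d i))"
  by (rule eq_matI) (auto simp: mat_diag_def)

lemma mat_adjoint_one [simp]: "mat_adjoint (1\<^sub>m n) = (1\<^sub>m n :: complex mat)"
  by (rule eq_matI) auto

lemma cscalar_prod_adjoint:
  fixes A :: "complex mat"
  assumes A: "A \<in> carrier_mat n m" and v: "v \<in> carrier_vec m" and w: "w \<in> carrier_vec n"
  shows "(A *\<^sub>v v) \<bullet>c w = v \<bullet>c (mat_adjoint A *\<^sub>v w)"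
proof -
  have "(A *\<^sub>v v) \<bullet>c w = (\<Sum>i<n. \<Sum>j<m. A $$ (i, j) * v $ j * cnj (w $ i))"
    using A v w by (simp add: scalar_prod_def sum_distrib_right atLeast0LessThan)
  also have "\<dots> = (\<Sum>j<m. \<Sum>i<n. A $$ (i, j) * v $ j * cnj (w $ i))"
    by (rule sum.swap)
  also have "\<dots> = v \<bullet>c (mat_adjoint A *\<^sub>v w)"
    using A v w
    by (simp add: scalar_prod_def sum_distrib_left atLeast0LessThan mult_ac)
  finally show ?thesis .
qed

lemma unitary_matI:
  assumes u: "u \<in> carrier_mat n n" and "mat_adjoint u * u = 1\<^sub>m n"
  shows "unitary_mat n u"
  using assms mat_mult_left_right_inverse[of "mat_adjoint u" n u] by (simp add: unitary_mat_def)

lemma unitary_mat_adjoint: "unitary_mat n u \<Longrightarrow> unitary_mat n (mat_adjoint u)"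
  by (simp add: unitary_mat_def)

definition diag_conj :: "nat \<Rightarrow> complex mat \<Rightarrow> (nat \<Rightarrow> real) \<Rightarrow> complex mat" where
  "diag_conj n u d = u * mat_diag n (\<lambda>i. complex_of_real (d i)) * mat_adjoint u"

lemma diagonalizes_diag_conj:
  "diagonalizes n u d a \<longleftrightarrow> unitary_mat n u \<and> a = diag_conj n u d"
  by (simp add: diagonalizes_def diag_conj_def)

lemma functional_calculus_diag_conj:
  "unitary_mat n u \<Longrightarrow> functional_calculus n f (diag_conj n u d) = diag_conj n u (\<lambda>i. f (d i))"
  using functional_calculus_eq[of n u d] by (simp add: diagonalizes_diag_conj diag_conj_def)

lemma diag_conj_carrier [simp, intro]:
  "u \<in> carrier_mat n n \<Longrightarrow> diag_conj n u d \<in> carrier_mat n n"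
  unfolding diag_conj_def by (metis mat_adjoint_carrier mat_diag_dim mult_carrier_mat)

lemma diag_conj_dim [simp]:
  "dim_row (diag_conj n u d) = dim_row u" "dim_col (diag_conj n u d) = dim_row u"
  by (simp_all add: diag_conj_def)

lemma diag_conj_index:
  assumes u: "u \<in> carrier_mat n n" and ij: "i < n" "j < n"
  shows "diag_conj n u d $$ (i, j) = (\<Sum>l<n. u $$ (i, l) * d l * cnj (u $$ (j, l)))"
  using assms unfolding diag_conj_def mat_diag_mult_right[OF u]
  by (simp add: scalar_prod_def atLeast0LessThan)

lemma diag_conj_cong:
  assumes "u \<in> carrier_mat n n" "\<And>i. i < n \<Longrightarrow> d i = e i"
  shows "diag_conj n u d = diag_conj n u e"
  using assms by (intro eq_matI) (simp_all add: diag_conj_index)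

lemma unitary_mat_mult:
  assumes "unitary_mat n u" "unitary_mat n v"
  shows "unitary_mat n (u * v)"
proof (rule unitary_matI)
  have C: "u \<in> carrier_mat n n" "v \<in> carrier_mat n n"
    and eq: "mat_adjoint u * u = 1\<^sub>m n" "mat_adjoint v * v = 1\<^sub>m n"
    using assms by (auto simp: unitary_mat_def)
  show "u * v \<in> carrier_mat n n" using C by simp
  have "mat_adjoint (u * v) * (u * v) = mat_adjoint v * ((mat_adjoint u * u) * v)"
    using C
    by (simp add: mat_adjoint_mult[where n = n and m = n and l = n]
      assoc_mult_mat[where n\<^sub>1 = n and n\<^sub>2 = n and n\<^sub>3 = n and n\<^sub>4 = n]
      mult_carrier_mat[where nr = n and n = n and nc = n])
  then show "mat_adjoint (u * v) * (u * v) = 1\<^sub>m n"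
    using C eq by simp
qed

lemma diag_conj_unitary_conj:
  assumes "w \<in> carrier_mat n n" "u \<in> carrier_mat n n"
  shows "w * diag_conj n u d * mat_adjoint w = diag_conj n (w * u) d"
  using assms
  by (simp add: diag_conj_def mat_adjoint_mult[where n = n and m = n and l = n]
    assoc_mult_mat[where n\<^sub>1 = n and n\<^sub>2 = n and n\<^sub>3 = n and n\<^sub>4 = n]
    mult_carrier_mat[where nr = n and n = n and nc = n])

lemma diag_conj_one:
  assumes "unitary_mat n u" "\<And>i. i < n \<Longrightarrow> d i = 1"
  shows "diag_conj n u d = 1\<^sub>m n"
proof -
  have "diag_conj n u d = diag_conj n u (\<lambda>_. 1)"
    using assms by (intro diag_conj_cong) (auto simp: unitary_mat_def)
  also have "\<dots> = u * mat_adjoint u"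
    using assms(1) by (simp add: diag_conj_def unitary_mat_def right_mult_one_mat[where nr = n and nc = n])
  finally show ?thesis
    using assms(1) by (simp add: unitary_mat_def)
qed

section \<open>The spectral theorem\<close>

lemma unitary_mat_extending:
  fixes v :: "complex vec"
  assumes v: "v \<in> carrier_vec n" and v0: "v \<noteq> 0\<^sub>v n"
  obtains u k where "unitary_mat n u" "0 < n" "col u 0 = k \<cdot>\<^sub>v v"
proof -
  have n: "0 < n" using v v0 by (cases n) auto
  interpret cof_vec_space n "TYPE(complex)" .
  \<comment> \<open>A basis with \<open>v\<close> in front is orthogonalized. Gram-Schmidt keeps its
    first vector, so the first column stays on the line of \<open>v\<close>, and normalizing it only
    introduces the factor \<open>k\<close>.\<close>
  define b where "b = basis_completion v"
  define ws where "ws = gram_schmidt n b"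
  note bc = basis_completion[OF v v0, folded b_def]
  obtain vs where bv: "b = v # vs"
    using bc(6,7) n by (cases b) auto
  have ws: "set ws \<subseteq> carrier_vec n" "corthogonal ws" "length ws = n"
    using gram_schmidt_result[OF bc(2) bc(4,5) refl] bc(6) by (auto simp: ws_def)
  have hd: "hd ws = v"
    using gram_schmidt_hd[OF v] by (simp add: ws_def bv)
  define W where "W = mat_of_cols n ws"
  have W: "W \<in> carrier_mat n n" "corthogonal_mat W"
    using ws mat_of_cols_carrier(1)[of n ws] orthogonal_mat_of_cols[of ws n] by (auto simp: W_def)
  have col0: "col W 0 = v"
    using ws hd n hd_conv_nth[of ws] v by (auto simp: W_def)
  \<comment> \<open>Inverse lengths of the columns: \<open>corthogonal_mat\<close> gives nonzero
    orthogonal columns, and right multiplication by a diagonal matrix rescales them.\<close>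
  define s where "s i = 1 / sqrt (Re (col W i \<bullet>c col W i))" for i
  define u where "u = W * mat_diag n (\<lambda>i. complex_of_real (s i))"
  have u: "u \<in> carrier_mat n n" using W by (simp add: u_def)
  have u_index: "u $$ (i, j) = W $$ (i, j) * s j" if "i < n" "j < n" for i j
    using that by (simp add: u_def mat_diag_mult_right[OF W(1)])
  have "mat_adjoint u * u = 1\<^sub>m n"
  proof (rule eq_matI)
    fix i j assume "i < dim_row (1\<^sub>m n :: complex mat)" "j < dim_col (1\<^sub>m n :: complex mat)"
    then have ij: "i < n" "j < n" by auto
    have "(mat_adjoint u * u) $$ (i, j) = (\<Sum>l<n. cnj (W $$ (l, i) * s i) * (W $$ (l, j) * s j))"
      using ij u u_index by (simp add: scalar_prod_def atLeast0LessThan)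
    also have "\<dots> = s i * s j * (col W j \<bullet>c col W i)"
      using ij W by (simp add: scalar_prod_def atLeast0LessThan sum_distrib_left mult_ac)
    also have "\<dots> = 1\<^sub>m n $$ (i, j)"
    proof (cases "i = j")
      case True
      have "0 < col W i \<bullet>c col W i"
        using corthogonal_matD[OF W(2), of i i] ij W conjugate_square_ge_0_vec[of "col W i"]
        by (auto simp: less_le)
      then have "0 < Re (col W i \<bullet>c col W i)" "col W i \<bullet>c col W i = Re (col W i \<bullet>c col W i)"
        by (auto simp: less_complex_def complex_eq_iff)
      moreover have "s i * s i * Re (col W i \<bullet>c col W i) = 1"
        using calculation(1) by (simp add: s_def)
      ultimately have "s i * s i * (col W i \<bullet>c col W i) = 1"
        by (metis of_real_1 of_real_mult)
      then show ?thesis using True ij by simp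
    next
      case False
      then show ?thesis using corthogonal_matD[OF W(2), of j i] ij W by auto
    qed
    finally show "(mat_adjoint u * u) $$ (i, j) = 1\<^sub>m n $$ (i, j)" .
  qed (use u in auto)
  then have "unitary_mat n u" using u by (rule unitary_matI[rotated])
  moreover have "col u 0 = complex_of_real (s 0) \<cdot>\<^sub>v v"
    unfolding col0[symmetric] using n W u u_index by (intro eq_vecI) auto
  ultimately show ?thesis using that n by blast
qed

text \<open>Deflation by induction on the size: a unitary matrix with an eigenvector along its first
  column brings \<open>a\<close> to a form whose first column is a multiple of the first unit
  vector. Selfadjointness clears the first row as well and makes the eigenvalue real; the remaining
  block is smaller and again selfadjoint.\<close>

theorem selfadjoint_mat_diagonalizes:
  assumes "selfadjoint_mat n a"
  obtains u d where "unitary_mat n u" "a = diag_conj n u d"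
proof -
  have "\<exists>u d. unitary_mat n u \<and> a = diag_conj n u d"
    using assms
  proof (induction n arbitrary: a)
    case 0
    then have "unitary_mat 0 a \<and> a = diag_conj 0 a (\<lambda>_. 0)"
      by (auto simp: selfadjoint_mat_def unitary_mat_def diag_conj_def intro!: eq_matI)
    then show ?case by blast
  next
    case (Suc m)
    define n where "n = Suc m"
    have a: "a \<in> carrier_mat n n" "mat_adjoint a = a"
      using Suc.prems by (auto simp: selfadjoint_mat_def n_def)
    obtain k v where v: "v \<in> carrier_vec n" "v \<noteq> 0\<^sub>v n" "a *\<^sub>v v = k \<cdot>\<^sub>v v"
      using spectrum_non_empty[OF a(1)] a(1)
      by (auto simp: n_def spectrum_def eigenvalue_def eigenvector_def)
    obtain w l where w: "unitary_mat n w" "col w 0 = l \<cdot>\<^sub>v v"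
      using unitary_mat_extending[OF v(1,2)] by metis
    have wC: "w \<in> carrier_mat n n" "mat_adjoint w * w = 1\<^sub>m n" "w * mat_adjoint w = 1\<^sub>m n"
      using w by (auto simp: unitary_mat_def)
    define B where "B = mat_adjoint w * a * w"
    have B: "B \<in> carrier_mat n n" "mat_adjoint B = B"
      using a wC by (auto simp: B_def mat_adjoint_mult[where n = n and m = n and l = n]
        assoc_mult_mat[where n\<^sub>1 = n and n\<^sub>2 = n and n\<^sub>3 = n and n\<^sub>4 = n])
    have B_sym: "B $$ (j, i) = cnj (B $$ (i, j))" if "i < n" "j < n" for i j
      using mat_adjoint_index[of j B i] B that by simp
    have "col B 0 = (mat_adjoint w * a) *\<^sub>v col w 0"
      using a wC by (auto simp: B_def n_def)
    also have "\<dots> = mat_adjoint w *\<^sub>v (a *\<^sub>v col w 0)"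
      using a wC by (intro assoc_mult_mat_vec) auto
    also have "a *\<^sub>v col w 0 = k \<cdot>\<^sub>v col w 0"
      using v a by (simp add: w mult_mat_vec[of a n n] smult_smult_assoc mult.commute)
    also have "mat_adjoint w *\<^sub>v (k \<cdot>\<^sub>v col w 0) = k \<cdot>\<^sub>v (mat_adjoint w *\<^sub>v col w 0)"
      using wC(1) by (intro mult_mat_vec[of _ n n]) (auto simp: n_def intro!: col_carrier_vec)
    also have "mat_adjoint w *\<^sub>v col w 0 = col (mat_adjoint w * w) 0"
      using wC(1) by (intro col_mult2[of _ n n _ n, symmetric]) (auto simp: n_def)
    finally have B_col0: "col B 0 = k \<cdot>\<^sub>v col (1\<^sub>m n) 0"
      by (simp add: wC)
    have B_col: "B $$ (i, 0) = (if i = 0 then k else 0)" if "i < n" for i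
      using that B(1) arg_cong[OF B_col0, of "\<lambda>x. x $ i"] by (auto simp: n_def)
    have B_row: "B $$ (0, i) = (if i = 0 then k else 0)" if "i < n" for i
      using that B_col B_sym[of i 0] by (auto simp: n_def)
    have k: "k = Re k"
      using B_sym[of 0 0] B_col[of 0] by (simp add: n_def complex_eq_iff)
    define A3 where "A3 = Matrix.mat m m (\<lambda>(i, j). B $$ (Suc i, Suc j))"
    have "mat_adjoint A3 = A3"
    proof (rule eq_matI)
      fix i j assume "i < dim_row A3" "j < dim_col A3"
      then show "mat_adjoint A3 $$ (i, j) = A3 $$ (i, j)"
        using B_sym[of "Suc j" "Suc i"] by (simp add: A3_def n_def)
    qed (simp_all add: A3_def)
    then have "selfadjoint_mat m A3"
      by (simp add: selfadjoint_mat_def A3_def)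
    then obtain p d where p: "unitary_mat m p" and A3: "A3 = diag_conj m p d"
      using Suc.IH by blast
    have pC: "p \<in> carrier_mat m m" "diag_conj m p (\<lambda>_. 1) = 1\<^sub>m m"
      using p diag_conj_one[OF p] by (auto simp: unitary_mat_def)
    \<comment> \<open>The block sum of the number 1 and \<open>p\<close>. \<open>P_index\<close>
      describes every \<open>diag_conj n P e\<close> as a block sum, which serves both the unitarity
      of \<open>P\<close>, with \<open>e\<close> constantly 1, and the diagonalization of
      \<open>B\<close>.\<close>
    define P where "P = Matrix.mat n n
      (\<lambda>(i, j). if i = 0 \<and> j = 0 then 1 else if i = 0 \<or> j = 0 then 0 else p $$ (i - 1, j - 1))"
    have PC: "P \<in> carrier_mat n n" by (simp add: P_def)
    have P_index: "diag_conj n P e $$ (i, j) =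
        (if i = 0 \<and> j = 0 then e 0 else if i = 0 \<or> j = 0 then 0
         else diag_conj m p (\<lambda>l. e (Suc l)) $$ (i - 1, j - 1))"
      if "i < n" "j < n" for e i j
      using that unfolding diag_conj_index[OF PC that]
      by (cases i; cases j)
        (simp_all add: n_def P_def sum.lessThan_Suc_shift diag_conj_index[OF pC(1)] del: sum.lessThan_Suc)
    have "P * mat_adjoint P = diag_conj n P (\<lambda>_. 1)"
      using PC by (simp add: diag_conj_def)
    also have "\<dots> = 1\<^sub>m n"
    proof (rule eq_matI)
      fix i j assume "i < dim_row (1\<^sub>m n :: complex mat)" "j < dim_col (1\<^sub>m n :: complex mat)"
      then have ij: "i < n" "j < n" by auto
      then show "diag_conj n P (\<lambda>_. 1) $$ (i, j) = 1\<^sub>m n $$ (i, j)"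
        using P_index[OF ij, of "\<lambda>_. 1"] by (cases i; cases j) (simp_all add: pC n_def)
    qed (use PC in simp_all)
    finally have P: "unitary_mat n P"
      using PC unitary_matI[of "mat_adjoint P" n] unitary_mat_adjoint[of n "mat_adjoint P"] by simp
    have "B = diag_conj n P (case_nat (Re k) d)"
    proof (rule eq_matI)
      fix i j assume "i < dim_row (diag_conj n P (case_nat (Re k) d))"
        "j < dim_col (diag_conj n P (case_nat (Re k) d))"
      then have ij: "i < n" "j < n" using PC by auto
      have "B $$ (i, j) = A3 $$ (i - 1, j - 1)" if "i \<noteq> 0" "j \<noteq> 0"
        using that ij by (simp add: A3_def n_def)
      then show "B $$ (i, j) = diag_conj n P (case_nat (Re k) d) $$ (i, j)"
        using ij B_row[of j] B_col[of i] k by (auto simp: P_index A3)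
    qed (use B PC in auto)
    moreover have "a = w * B * mat_adjoint w"
    proof -
      have "w * B * mat_adjoint w = (w * mat_adjoint w) * a * (w * mat_adjoint w)"
        using a(1) wC(1) unfolding B_def
        by (simp add: assoc_mult_mat[where n\<^sub>1 = n and n\<^sub>2 = n and n\<^sub>3 = n and n\<^sub>4 = n]
          mult_carrier_mat[where nr = n and n = n and nc = n])
      then show ?thesis using a(1) by (simp add: wC)
    qed
    ultimately have "a = diag_conj n (w * P) (case_nat (Re k) d)"
      using diag_conj_unitary_conj wC PC by simp
    with unitary_mat_mult[OF w(1) P] show ?case unfolding n_def by blast
  qed
  then show ?thesis using that by blast
qed

section \<open>Functional calculus and quadratic forms\<close>

text \<open>For selfadjoint matrices the form is real already, so the real part loses nothing and
  makes inequalities and limits those of real numbers.\<close>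

definition quad_form :: "complex mat \<Rightarrow> complex vec \<Rightarrow> real" where
  "quad_form a v = Re ((a *\<^sub>v v) \<bullet>c v)"

context
  fixes n :: nat
begin

private lemmas assoc = assoc_mult_mat[where n\<^sub>1 = n and n\<^sub>2 = n and n\<^sub>3 = n and n\<^sub>4 = n]
private lemmas mult = mult_carrier_mat[where nr = n and n = n and nc = n]
private lemmas one = left_mult_one_mat[where nr = n and nc = n] right_mult_one_mat[where nr = n and nc = n]
private lemmas adj_mult = mat_adjoint_mult[where n = n and m = n and l = n]
private lemmas mult_vec = mult_mat_vec_carrier[where nr = n and n = n]
private lemmas assoc_vec = assoc_mult_mat_vec[where n\<^sub>1 = n and n\<^sub>2 = n and n\<^sub>3 = n]

lemma mat_adjoint_diag_conj [simp]:
  assumes "u \<in> carrier_mat n n"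
  shows "mat_adjoint (diag_conj n u d) = diag_conj n u d"
  using assms by (simp add: diag_conj_def adj_mult assoc mult)

lemma diag_conj_mult:
  assumes "unitary_mat n u"
  shows "diag_conj n u d * diag_conj n u e = diag_conj n u (\<lambda>i. d i * e i)"
proof -
  define D where "D d = mat_diag n (\<lambda>i. complex_of_real (d i))" for d :: "nat \<Rightarrow> real"
  have D: "D d \<in> carrier_mat n n" "D d * D e = D (\<lambda>i. d i * e i)" for d e
    by (simp_all add: D_def)
  have u: "u \<in> carrier_mat n n" "mat_adjoint u * u = 1\<^sub>m n"
    using assms by (auto simp: unitary_mat_def)
  have "diag_conj n u d * diag_conj n u e = u * D d * (mat_adjoint u * u) * D e * mat_adjoint u"
    using u(1) D(1) unfolding diag_conj_def D_def[symmetric] by (simp add: assoc mult)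
  also have "\<dots> = u * (D d * D e) * mat_adjoint u"
    unfolding u(2) using u(1) D(1) by (simp add: assoc mult one)
  finally show ?thesis
    unfolding D(2) unfolding D_def diag_conj_def .
qed

text \<open>The matrix \<open>w = v\<^sup>* x u\<close> intertwines the two diagonal matrices, so \<open>w\<close> vanishes at every
  position where their entries differ.\<close>

lemma diag_conj_intertwine:
  assumes "unitary_mat n u" "unitary_mat n v" and x: "x \<in> carrier_mat n n"
    and eq: "x * diag_conj n u d = diag_conj n v e * x"
  shows "x * diag_conj n u (\<lambda>i. f (d i)) = diag_conj n v (\<lambda>i. f (e i)) * x"
proof -
  define D where "D d = mat_diag n (\<lambda>i. complex_of_real (d i))" for d :: "nat \<Rightarrow> real"
  define U where "U = mat_adjoint u"
  define V where "V = mat_adjoint v"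
  have u: "u \<in> carrier_mat n n" "U * u = 1\<^sub>m n" "u * U = 1\<^sub>m n"
    and v: "v \<in> carrier_mat n n" "V * v = 1\<^sub>m n" "v * V = 1\<^sub>m n"
    using assms by (auto simp: unitary_mat_def U_def V_def)
  have U: "U \<in> carrier_mat n n" and V: "V \<in> carrier_mat n n"
    using u v by (auto simp: U_def V_def)
  have D: "D d \<in> carrier_mat n n" for d by (simp add: D_def)
  define w where "w = V * x * u"
  have w: "w \<in> carrier_mat n n" using u v V x by (simp add: w_def mult)
  note C = x U V D w u(1) v(1)
  have entries: "(w * D p) $$ (i, j) = w $$ (i, j) * complex_of_real (p j)"
    "(D q * w) $$ (i, j) = complex_of_real (q i) * w $$ (i, j)"
    if "i < n" "j < n" for p q i j
    using that w by (simp_all add: D_def mat_diag_mult_left[OF w] mat_diag_mult_right[OF w])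
  have xu: "x * diag_conj n u p = v * (w * D p) * U" for p
  proof -
    have "x * diag_conj n u p = (v * V) * (x * (u * (D p * U)))"
      unfolding v(3) using C by (simp add: diag_conj_def D_def U_def assoc mult)
    then show ?thesis using C by (simp add: w_def assoc mult)
  qed
  have vx: "diag_conj n v q * x = v * (D q * w) * U" for q
  proof -
    have "diag_conj n v q * x = v * (D q * (V * (x * (u * U))))"
      unfolding u(3) using C by (simp add: diag_conj_def D_def V_def assoc mult)
    then show ?thesis using C by (simp add: w_def assoc mult)
  qed
  \<comment> \<open>As \<open>u\<close> and \<open>v\<close> are invertible, the relation for
    \<open>x\<close> passes to one for \<open>w\<close>, which can be compared entry by
    entry.\<close>
  have cancel: "V * (v * y * U) * u = y" if "y \<in> carrier_mat n n" for y
  proof -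
    have "V * (v * y * U) * u = (V * v) * y * (U * u)"
      using C that by (simp add: assoc mult)
    then show ?thesis using that by (simp add: u v)
  qed
  have "V * (v * (w * D d) * U) * u = V * (v * (D e * w) * U) * u"
    using eq xu vx by metis
  then have wD: "w * D d = D e * w"
    using cancel[of "w * D d"] cancel[of "D e * w"] C by (simp add: mult)
  have "w * D (\<lambda>i. f (d i)) = D (\<lambda>i. f (e i)) * w"
  proof (rule eq_matI)
    fix i j assume "i < dim_row (D (\<lambda>i. f (e i)) * w)" "j < dim_col (D (\<lambda>i. f (e i)) * w)"
    then have ij: "i < n" "j < n" using w D[of "\<lambda>i. f (e i)"] by auto
    have "w $$ (i, j) = 0 \<or> d j = e i"
      using entries(1)[OF ij, of d] entries(2)[OF ij, of e] unfolding wD by auto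
    then show "(w * D (\<lambda>i. f (d i))) $$ (i, j) = (D (\<lambda>i. f (e i)) * w) $$ (i, j)"
      using entries[OF ij] by auto
  qed (use w D[of "\<lambda>i. f (d i)"] D[of "\<lambda>i. f (e i)"] in auto)
  then show ?thesis
    by (simp add: xu vx)
qed

section \<open>Quadratic forms in an eigenbasis\<close>

lemma cscalar_prod_conj:
  fixes x :: "complex mat"
  assumes "x \<in> carrier_mat n n" "a \<in> carrier_mat n n" "v \<in> carrier_vec n"
  shows "((mat_adjoint x * a * x) *\<^sub>v v) \<bullet>c v = (a *\<^sub>v (x *\<^sub>v v)) \<bullet>c (x *\<^sub>v v)"
proof -
  have "(mat_adjoint x * a * x) *\<^sub>v v = mat_adjoint x *\<^sub>v (a *\<^sub>v (x *\<^sub>v v))"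
    using assms by (simp add: assoc_vec mult mult_vec)
  then show ?thesis
    using assms cscalar_prod_adjoint[of "mat_adjoint x" n n "a *\<^sub>v (x *\<^sub>v v)" v]
    by (simp add: mult_vec)
qed

lemma quad_form_conj:
  assumes "x \<in> carrier_mat n n" "a \<in> carrier_mat n n" "v \<in> carrier_vec n"
  shows "quad_form (mat_adjoint x * a * x) v = quad_form a (x *\<^sub>v v)"
  using cscalar_prod_conj[OF assms] by (simp add: quad_form_def)

lemma quad_form_adjoint_mult:
  assumes "x \<in> carrier_mat n n" "v \<in> carrier_vec n"
  shows "quad_form (mat_adjoint x * x) v = quad_form (1\<^sub>m n) (x *\<^sub>v v)"
  using quad_form_conj[of x "1\<^sub>m n" v] assms by (simp add: one)

text \<open>For unitary \<open>u\<close> this is the form in eigenbasis coordinates, squared moduli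
  weighted by the eigenvalues. That it is real lets \<open>psd_mat_iff\<close> replace the complex
  order by the real one.\<close>

lemma cscalar_prod_diag_conj:
  assumes u: "u \<in> carrier_mat n n" and v: "v \<in> carrier_vec n"
  shows "(diag_conj n u d *\<^sub>v v) \<bullet>c v =
    complex_of_real (\<Sum>i<n. d i * (cmod ((mat_adjoint u *\<^sub>v v) $ i))\<^sup>2)"
proof -
  define w where "w = mat_adjoint u *\<^sub>v v"
  have w: "w \<in> carrier_vec n" using u v by (simp add: w_def mult_vec)
  define D where "D = mat_diag n (\<lambda>i. complex_of_real (d i))"
  have Dw: "(D *\<^sub>v w) $ i = d i * w $ i" if "i < n" for i
  proof -
    have "(D *\<^sub>v w) $ i = (\<Sum>j<n. (if i = j then complex_of_real (d j) else 0) * w $ j)"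
      using that w by (simp add: D_def mat_diag_def scalar_prod_def atLeast0LessThan)
    also have "\<dots> = (\<Sum>j<n. if j = i then complex_of_real (d j) * w $ j else 0)"
      by (intro sum.cong) auto
    finally show ?thesis using that by simp
  qed
  have "(diag_conj n u d *\<^sub>v v) \<bullet>c v = (D *\<^sub>v w) \<bullet>c w"
    using cscalar_prod_conj[of "mat_adjoint u" D v] u v by (simp add: diag_conj_def D_def w_def)
  also have "\<dots> = (\<Sum>i<n. (D *\<^sub>v w) $ i * cnj (w $ i))"
    using w by (simp add: scalar_prod_def atLeast0LessThan)
  also have "\<dots> = (\<Sum>i<n. complex_of_real (d i * (cmod (w $ i))\<^sup>2))"
    by (intro sum.cong) (simp_all add: Dw mult.assoc complex_norm_square del: of_real_power)
  finally show ?thesis by (simp add: w_def)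
qed

lemma quad_form_diag_conj:
  assumes "u \<in> carrier_mat n n" "v \<in> carrier_vec n"
  shows "quad_form (diag_conj n u d) v = (\<Sum>i<n. d i * (cmod ((mat_adjoint u *\<^sub>v v) $ i))\<^sup>2)"
  using cscalar_prod_diag_conj[OF assms] by (simp add: quad_form_def)

lemma quad_form_diag_conj_mono:
  assumes "u \<in> carrier_mat n n" "v \<in> carrier_vec n" "\<And>i. i < n \<Longrightarrow> d i \<le> e i"
  shows "quad_form (diag_conj n u d) v \<le> quad_form (diag_conj n u e) v"
  using assms by (auto simp: quad_form_diag_conj intro!: sum_mono mult_right_mono)

lemma quad_form_diag_conj_tendsto:
  assumes "u \<in> carrier_mat n n" "v \<in> carrier_vec n" "\<And>i. i < n \<Longrightarrow> ((\<lambda>s. d s i) \<longlongrightarrow> e i) F"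
  shows "((\<lambda>s. quad_form (diag_conj n u (d s)) v) \<longlongrightarrow> quad_form (diag_conj n u e) v) F"
  using assms by (auto simp: quad_form_diag_conj intro!: tendsto_intros)

lemma quad_form_one_nonneg:
  assumes "v \<in> carrier_vec n"
  shows "0 \<le> quad_form (1\<^sub>m n) v"
proof -
  have "unitary_mat n (1\<^sub>m n)" by (simp add: unitary_mat_def)
  then show ?thesis
    using quad_form_diag_conj_mono[of "1\<^sub>m n" v "\<lambda>_. 0" "\<lambda>_. 1"] assms
      quad_form_diag_conj[of "1\<^sub>m n" v "\<lambda>_. 0"]
    by (simp add: diag_conj_one)
qed

lemma quad_form_diag_conj_add_const:
  assumes "unitary_mat n u" "v \<in> carrier_vec n"
  shows "quad_form (diag_conj n u (\<lambda>i. d i + s)) v =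
    quad_form (diag_conj n u d) v + s * quad_form (1\<^sub>m n) v"
  using assms unfolding diag_conj_one[OF assms(1), of "\<lambda>_. 1", OF refl, symmetric]
  by (simp add: unitary_mat_def quad_form_diag_conj sum.distrib sum_distrib_left algebra_simps)

text \<open>The vector is the \<open>i\<close>-th column of \<open>u\<close>. It does not depend on
  \<open>d\<close>, so a single vector reads off the \<open>i\<close>-th eigenvalue of every
  function of the same matrix, and bounds on forms become bounds on eigenvalues.\<close>

lemma diag_conj_eigenvector:
  assumes u: "unitary_mat n u" and i: "i < n"
  obtains v where "v \<in> carrier_vec n" "quad_form (1\<^sub>m n) v = 1"
    "\<And>d. quad_form (diag_conj n u d) v = d i"
proof -
  have uC: "u \<in> carrier_mat n n" "mat_adjoint u * u = 1\<^sub>m n"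
    using u by (auto simp: unitary_mat_def)
  define v where "v = u *\<^sub>v unit_vec n i"
  have v: "v \<in> carrier_vec n" using uC by (simp add: v_def mult_vec)
  have "mat_adjoint u *\<^sub>v v = (mat_adjoint u * u) *\<^sub>v unit_vec n i"
    using uC(1) by (simp add: v_def assoc_vec)
  then have adj_v: "mat_adjoint u *\<^sub>v v = unit_vec n i"
    by (simp add: uC)
  have q: "quad_form (diag_conj n u d) v = d i" for d
  proof -
    have "quad_form (diag_conj n u d) v = (\<Sum>j<n. if j = i then d j else 0)"
      unfolding quad_form_diag_conj[OF uC(1) v] adj_v using i by (intro sum.cong) auto
    then show ?thesis using i by simp
  qed
  moreover have "quad_form (1\<^sub>m n) v = 1"
    using q[of "\<lambda>_. 1"] diag_conj_one[OF u, of "\<lambda>_. 1"] by simp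
  ultimately show ?thesis using that v by blast
qed

lemma quad_form_diag_conj_sandwich:
  assumes "unitary_mat n u" "v \<in> carrier_vec n"
  shows "quad_form (diag_conj n u d) (diag_conj n u e *\<^sub>v v) =
    quad_form (diag_conj n u (\<lambda>i. e i * d i * e i)) v"
proof -
  have u: "u \<in> carrier_mat n n" using assms by (simp add: unitary_mat_def)
  show ?thesis
    using quad_form_conj[of "diag_conj n u e" "diag_conj n u d" v] u assms
    by (simp add: diag_conj_mult)
qed

lemma selfadjoint_mat_diag_conj: "unitary_mat n u \<Longrightarrow> selfadjoint_mat n (diag_conj n u d)"
  by (simp add: selfadjoint_mat_def unitary_mat_def)

lemma selfadjoint_mat_conj:
  "selfadjoint_mat n a \<Longrightarrow> x \<in> carrier_mat n n \<Longrightarrow> selfadjoint_mat n (mat_adjoint x * a * x)"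
  by (simp add: selfadjoint_mat_def adj_mult assoc mult)

section \<open>Positivity, the Loewner order, spectra and contractions through quadratic
  forms\<close>

lemma psd_mat_iff:
  "psd_mat n a \<longleftrightarrow> selfadjoint_mat n a \<and> (\<forall>v\<in>carrier_vec n. 0 \<le> quad_form a v)"
proof (cases "selfadjoint_mat n a")
  case True
  then obtain u d where u: "unitary_mat n u" and a: "a = diag_conj n u d"
    by (rule selfadjoint_mat_diagonalizes)
  then have uC: "u \<in> carrier_mat n n" by (simp add: unitary_mat_def)
  have "0 \<le> (a *\<^sub>v v) \<bullet>c v \<longleftrightarrow> 0 \<le> quad_form a v" if "v \<in> carrier_vec n" for v
    unfolding a quad_form_def cscalar_prod_diag_conj[OF uC that] by (simp add: less_eq_complex_def)
  then show ?thesis by (auto simp: psd_mat_def)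
qed (simp add: psd_mat_def)

text \<open>The form of \<open>b - a\<close> is the difference of the two forms, so the order is
  decided vector by vector, and limits of matrix inequalities reduce to limits of real ones.\<close>

lemma loewner_le_iff:
  assumes "selfadjoint_mat n a" "selfadjoint_mat n b"
  shows "loewner_le n a b \<longleftrightarrow> (\<forall>v\<in>carrier_vec n. quad_form a v \<le> quad_form b v)"
proof -
  have C: "a \<in> carrier_mat n n" "b \<in> carrier_mat n n" and adj: "mat_adjoint a = a" "mat_adjoint b = b"
    using assms by (auto simp: selfadjoint_mat_def)
  have "mat_adjoint (b - a) = mat_adjoint b - mat_adjoint a"
    using C by (intro eq_matI) auto
  then have "selfadjoint_mat n (b - a)"
    using C by (simp add: selfadjoint_mat_def adj minus_carrier_mat)
  moreover have "quad_form (b - a) v = quad_form b v - quad_form a v" if "v \<in> carrier_vec n" for v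
    using that C unfolding quad_form_def
    by (simp add: minus_mult_distrib_mat_vec[of _ n n] minus_scalar_prod_distrib[of _ n] mult_vec)
  ultimately show ?thesis
    using assms by (simp add: loewner_le_def psd_mat_iff)
qed

text \<open>Unitary conjugation is a similarity and keeps the characteristic polynomial, whose roots
  for a diagonal matrix are the diagonal entries. Hence only the values of \<open>d\<close> below
  \<open>n\<close> count.\<close>

lemma spectrum_in_diag_conj:
  assumes "unitary_mat n u"
  shows "spectrum_in (diag_conj n u d) I \<longleftrightarrow> (\<forall>i<n. d i \<in> I)"
proof -
  define D where "D = mat_diag n (\<lambda>i. complex_of_real (d i))"
  have u: "u \<in> carrier_mat n n" "mat_adjoint u * u = 1\<^sub>m n" "u * mat_adjoint u = 1\<^sub>m n"
    using assms by (auto simp: unitary_mat_def)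
  have D: "D \<in> carrier_mat n n" "upper_triangular D"
    by (auto simp: D_def mat_diag_def)
  have "similar_mat (diag_conj n u d) D"
    using u D by (intro similar_matI[of _ _ u "mat_adjoint u" n]) (auto simp: diag_conj_def D_def)
  then have "spectrum (diag_conj n u d) = spectrum D"
    using spectrum_root_char_poly[OF D(1)] spectrum_root_char_poly[OF diag_conj_carrier[OF u(1)]]
      char_poly_similar by metis
  also have "\<dots> = set (diag_mat D)"
    unfolding spectrum_root_char_poly[OF D(1)] char_poly_upper_triangular[OF D]
    by (auto simp: poly_prod_list prod_list_zero_iff)
  also have "\<dots> = (\<lambda>i. complex_of_real (d i)) ` {..<n}"
    using D(1) by (auto simp: diag_mat_def D_def mat_diag_def)
  finally show ?thesis
    by (auto simp: spectrum_in_def)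
qed

lemma contraction_mat_iff:
  "contraction_mat n c \<longleftrightarrow> c \<in> carrier_mat n n \<and>
    (\<forall>v\<in>carrier_vec n. quad_form (1\<^sub>m n) (c *\<^sub>v v) \<le> quad_form (1\<^sub>m n) v)"
proof (cases "c \<in> carrier_mat n n")
  case True
  then have "selfadjoint_mat n (mat_adjoint c * c)" "selfadjoint_mat n (1\<^sub>m n)"
    by (auto simp: selfadjoint_mat_def adj_mult mult)
  then show ?thesis
    using True quad_form_adjoint_mult by (simp add: contraction_mat_def loewner_le_iff)
qed (simp add: contraction_mat_def)

text \<open>On an eigenvector of \<open>c c\<^sup>*\<close> with eigenvalue \<open>d\<close>, the bound on \<open>c\<close> gives \<open>d\<^sup>2 \<le> d\<close>.\<close>

lemma contraction_mat_adjoint: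
  assumes c: "contraction_mat n c"
  shows "contraction_mat n (mat_adjoint c)"
proof -
  have cC: "c \<in> carrier_mat n n"
    and le: "\<And>v. v \<in> carrier_vec n \<Longrightarrow> quad_form (1\<^sub>m n) (c *\<^sub>v v) \<le> quad_form (1\<^sub>m n) v"
    using c by (auto simp: contraction_mat_iff)
  have "selfadjoint_mat n (c * mat_adjoint c)"
    using cC by (auto simp: selfadjoint_mat_def adj_mult mult)
  then obtain u d where u: "unitary_mat n u" and eq: "c * mat_adjoint c = diag_conj n u d"
    by (rule selfadjoint_mat_diagonalizes)
  have uC: "u \<in> carrier_mat n n" using u by (simp add: unitary_mat_def)
  have q: "quad_form (1\<^sub>m n) (mat_adjoint c *\<^sub>v v) = quad_form (diag_conj n u d) v"
    if "v \<in> carrier_vec n" for v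
    using quad_form_adjoint_mult[of "mat_adjoint c" v] cC that by (simp add: eq)
  have d: "d i \<le> 1" if i: "i < n" for i
  proof -
    obtain v where v: "v \<in> carrier_vec n" "\<And>d. quad_form (diag_conj n u d) v = d i"
      using diag_conj_eigenvector[OF u i] by metis
    have "quad_form (1\<^sub>m n) (c *\<^sub>v (mat_adjoint c *\<^sub>v v)) = quad_form (1\<^sub>m n) (diag_conj n u d *\<^sub>v v)"
      using cC v(1) by (simp add: assoc_vec flip: eq)
    also have "\<dots> = quad_form (diag_conj n u (\<lambda>i. d i * d i)) v"
      using quad_form_adjoint_mult[of "diag_conj n u d" v] uC v(1) by (simp add: diag_conj_mult[OF u])
    finally have "d i * d i = quad_form (1\<^sub>m n) (c *\<^sub>v (mat_adjoint c *\<^sub>v v))"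
      by (simp add: v(2))
    also have "\<dots> \<le> quad_form (1\<^sub>m n) (mat_adjoint c *\<^sub>v v)"
      using cC v(1) by (intro le) (simp add: mult_vec)
    also have "\<dots> = d i"
      by (simp add: q v)
    finally have "d i * d i \<le> d i" .
    then show ?thesis
      using mult_strict_left_mono[of 1 "d i" "d i"] by (cases "1 < d i") auto
  qed
  have "quad_form (diag_conj n u d) v \<le> quad_form (1\<^sub>m n) v" if "v \<in> carrier_vec n" for v
    using quad_form_diag_conj_mono[OF uC that, of d "\<lambda>_. 1"] d diag_conj_one[OF u, of "\<lambda>_. 1"] by simp
  then show ?thesis
    using cC q by (simp add: contraction_mat_iff)
qed

section \<open>Contraction inequalities and monotonicity\<close>

lemma unitary_mat_one: "unitary_mat n (1\<^sub>m n)"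
  by (simp add: unitary_mat_def)

lemma quad_form_diag_conj_le:
  assumes "unitary_mat n u" "v \<in> carrier_vec n" "\<And>i. i < n \<Longrightarrow> d i \<le> e i + s"
  shows "quad_form (diag_conj n u d) v \<le> quad_form (diag_conj n u e) v + s * quad_form (1\<^sub>m n) v"
  using quad_form_diag_conj_mono[of u v d "\<lambda>i. e i + s"] quad_form_diag_conj_add_const assms
  by (simp add: unitary_mat_def)

lemma quad_form_diag_conj_bounds:
  assumes "unitary_mat n u" "v \<in> carrier_vec n" "\<And>i. i < n \<Longrightarrow> d i \<in> {0..M}"
  shows "0 \<le> quad_form (diag_conj n u d) v"
    and "quad_form (diag_conj n u d) v \<le> M * quad_form (1\<^sub>m n) v"
proof -
  have u: "u \<in> carrier_mat n n" using assms(1) by (simp add: unitary_mat_def)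
  have zero: "quad_form (diag_conj n u (\<lambda>_. 0)) v = 0"
    using quad_form_diag_conj[OF u assms(2)] by simp
  show "0 \<le> quad_form (diag_conj n u d) v"
    using quad_form_diag_conj_mono[OF u assms(2), of "\<lambda>_. 0" d] assms(3) zero by auto
  show "quad_form (diag_conj n u d) v \<le> M * quad_form (1\<^sub>m n) v"
    using quad_form_diag_conj_le[OF assms(1,2), of d "\<lambda>_. 0" M] assms(3) zero by auto
qed

lemma diag_conj_eigenvalue_bounds:
  assumes "unitary_mat n u" "i < n"
    and "\<And>v. v \<in> carrier_vec n \<Longrightarrow> 0 \<le> quad_form (diag_conj n u d) v"
    and "\<And>v. v \<in> carrier_vec n \<Longrightarrow> quad_form (diag_conj n u d) v \<le> M * quad_form (1\<^sub>m n) v"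
  shows "d i \<in> {0..M}"
proof -
  obtain v where "v \<in> carrier_vec n" "quad_form (1\<^sub>m n) v = 1"
    "\<And>d. quad_form (diag_conj n u d) v = d i"
    using diag_conj_eigenvector[OF assms(1,2)] by metis
  then show ?thesis using assms(3)[of v] assms(4)[of v] by simp
qed

lemma psd_mat_diag_conj:
  assumes "unitary_mat n u" "\<And>i. i < n \<Longrightarrow> 0 \<le> d i"
  shows "psd_mat n (diag_conj n u d)"
  using assms
  by (auto simp: psd_mat_iff selfadjoint_mat_diag_conj quad_form_diag_conj unitary_mat_def
    intro!: sum_nonneg)

text \<open>The form of \<open>c\<^sup>* a c\<close> at \<open>w\<close> is that of \<open>a\<close>
  at \<open>c w\<close>, and \<open>c w\<close> is at most as long as \<open>w\<close>;
  nonnegativity of \<open>M\<close> carries the upper bound over. This keeps the spectrum of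
  \<open>c\<^sup>* a c\<close> inside the domain of \<open>f\<close>.\<close>

lemma contraction_conj_eigenvalue_bounds:
  assumes u: "unitary_mat n u" and c: "contraction_mat n c" and v: "unitary_mat n v"
    and eq: "mat_adjoint c * diag_conj n u d * c = diag_conj n v e"
    and d: "\<And>i. i < n \<Longrightarrow> d i \<in> {0..M}" and M: "0 \<le> M" and i: "i < n"
  shows "e i \<in> {0..M}"
proof (rule diag_conj_eigenvalue_bounds[OF v i])
  have cC: "c \<in> carrier_mat n n"
    and c_le: "\<And>w. w \<in> carrier_vec n \<Longrightarrow> quad_form (1\<^sub>m n) (c *\<^sub>v w) \<le> quad_form (1\<^sub>m n) w"
    using c by (auto simp: contraction_mat_iff)
  have uC: "u \<in> carrier_mat n n" using u by (simp add: unitary_mat_def)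
  fix w :: "complex vec" assume w: "w \<in> carrier_vec n"
  then have cw: "c *\<^sub>v w \<in> carrier_vec n" using cC by (simp add: mult_vec)
  have q: "quad_form (diag_conj n v e) w = quad_form (diag_conj n u d) (c *\<^sub>v w)"
    using quad_form_conj[OF cC diag_conj_carrier[OF uC, of d] w] by (simp add: eq)
  show "0 \<le> quad_form (diag_conj n v e) w"
    unfolding q by (rule quad_form_diag_conj_bounds(1)[OF u cw d])
  have "quad_form (diag_conj n v e) w \<le> M * quad_form (1\<^sub>m n) (c *\<^sub>v w)"
    unfolding q by (rule quad_form_diag_conj_bounds(2)[OF u cw d])
  also have "\<dots> \<le> M * quad_form (1\<^sub>m n) w"
    using c_le[OF w] M by (rule mult_left_mono)
  finally show "quad_form (diag_conj n v e) w \<le> M * quad_form (1\<^sub>m n) w" .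
qed

text \<open>The hypothesis is applied to the larger matrix \<open>b\<close>, since it is
  \<open>b\<close> that a contraction shrinks to \<open>a\<close>. All eigenvalues are positive
  here, so the square roots can be inverted.\<close>

lemma n_monotone_if_contraction_inequality:
  assumes H: "\<And>a c. psd_mat n a \<Longrightarrow> spectrum_in a S \<Longrightarrow> contraction_mat n c \<Longrightarrow>
      loewner_le n (functional_calculus n f (mat_adjoint c * a * c))
        (mat_adjoint c * functional_calculus n f a * c)"
    and g: "\<And>t. t \<in> S \<Longrightarrow> 0 < t \<Longrightarrow> g t = f t / t"
  shows "n_monotone n (S \<inter> {0<..}) g"
  unfolding n_monotone_def
proof (intro allI impI)
  fix a b
  assume sa: "selfadjoint_mat n a" and sb: "selfadjoint_mat n b" and le: "loewner_le n a b"
    and spa: "spectrum_in a (S \<inter> {0<..})" and spb: "spectrum_in b (S \<inter> {0<..})"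
  obtain u d where u: "unitary_mat n u" and a: "a = diag_conj n u d"
    using selfadjoint_mat_diagonalizes[OF sa] .
  obtain v e where v: "unitary_mat n v" and b: "b = diag_conj n v e"
    using selfadjoint_mat_diagonalizes[OF sb] .
  have d: "d i \<in> S" "0 < d i" and e: "e i \<in> S" "0 < e i" if "i < n" for i
    using spa spb that by (auto simp: a b spectrum_in_diag_conj u v)
  have uC: "u \<in> carrier_mat n n" and vC: "v \<in> carrier_mat n n"
    using u v by (auto simp: unitary_mat_def)
  define r where "r = diag_conj n u (\<lambda>i. sqrt (d i))"
  define r' where "r' = diag_conj n u (\<lambda>i. 1 / sqrt (d i))"
  define s' where "s' = diag_conj n v (\<lambda>i. 1 / sqrt (e i))"
  have rr: "r * r = a"
    unfolding r_def a diag_conj_mult[OF u] using d(2) by (intro diag_conj_cong[OF uC]) (simp add: less_imp_le)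
  have rr': "r * r' = 1\<^sub>m n"
    unfolding r_def r'_def diag_conj_mult[OF u] using d(2) by (intro diag_conj_one[OF u]) force
  have sbs: "s' * b * s' = 1\<^sub>m n"
    unfolding s'_def b diag_conj_mult[OF v]
  proof (rule diag_conj_one[OF v])
    fix i assume "i < n"
    then show "1 / sqrt (e i) * e i * (1 / sqrt (e i)) = 1" using e(2)[of i] by simp
  qed
  have C: "a \<in> carrier_mat n n" "b \<in> carrier_mat n n" "r \<in> carrier_mat n n" "r' \<in> carrier_mat n n"
    "s' \<in> carrier_mat n n"
    using uC vC by (auto simp: a b r_def r'_def s'_def)
  have adj: "mat_adjoint r = r" "mat_adjoint r' = r'" "mat_adjoint s' = s'"
    using uC vC by (auto simp: r_def r'_def s'_def)
  define c where "c = s' * r"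
  have cC: "c \<in> carrier_mat n n" using C by (simp add: c_def mult)
  have adj_c: "mat_adjoint c = r * s'" using C by (simp add: c_def adj_mult adj)
  \<comment> \<open>Here \<open>c c\<^sup>* = s' a s'\<close> is bounded by
    \<open>s' b s' = 1\<close> directly from the order of \<open>a\<close> and \<open>b\<close>.
    Bounding \<open>c\<^sup>* c\<close> instead would require the reversed order of the
    inverses.\<close>
  have "contraction_mat n (mat_adjoint c)"
    unfolding contraction_mat_iff
  proof (intro conjI ballI)
    fix w :: "complex vec" assume w: "w \<in> carrier_vec n"
    then have sw: "s' *\<^sub>v w \<in> carrier_vec n" using C by (simp add: mult_vec)
    have "quad_form (1\<^sub>m n) (mat_adjoint c *\<^sub>v w) = quad_form (1\<^sub>m n) (r *\<^sub>v (s' *\<^sub>v w))"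
      using C w by (simp add: adj_c assoc_vec)
    also have "\<dots> = quad_form a (s' *\<^sub>v w)"
      using quad_form_adjoint_mult[OF C(3) sw] by (simp add: adj rr)
    also have "\<dots> \<le> quad_form b (s' *\<^sub>v w)"
      using le sw by (simp add: loewner_le_iff sa sb)
    also have "\<dots> = quad_form (1\<^sub>m n) w"
      using quad_form_conj[OF C(5) C(2) w] by (simp add: adj sbs)
    finally show "quad_form (1\<^sub>m n) (mat_adjoint c *\<^sub>v w) \<le> quad_form (1\<^sub>m n) w" .
  qed (use cC in simp)
  then have "contraction_mat n c"
    using contraction_mat_adjoint[of "mat_adjoint c"] by simp
  moreover have "psd_mat n b" "spectrum_in b S"
    using e by (auto simp: b spectrum_in_diag_conj v less_imp_le intro!: psd_mat_diag_conj)
  moreover have "mat_adjoint c * b * c = a"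
  proof -
    have "mat_adjoint c * b * c = r * (s' * b * s') * r"
      using C by (simp add: adj_c) (simp add: c_def assoc mult)
    then show ?thesis using C by (simp add: sbs one rr)
  qed
  ultimately have L: "loewner_le n (functional_calculus n f a)
      (mat_adjoint c * functional_calculus n f b * c)"
    using H[of b c] by simp
  have fa: "functional_calculus n f a = diag_conj n u (\<lambda>i. f (d i))"
    and ga: "functional_calculus n g a = diag_conj n u (\<lambda>i. g (d i))"
    and fb: "functional_calculus n f b = diag_conj n v (\<lambda>i. f (e i))"
    and gb: "functional_calculus n g b = diag_conj n v (\<lambda>i. g (e i))"
    by (simp_all add: a b functional_calculus_diag_conj u v)
  have scale: "1 / sqrt t * f t * (1 / sqrt t) = g t" if "t \<in> S" "0 < t" for t
    using that by (simp add: g)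
  have "quad_form (functional_calculus n g a) w \<le> quad_form (functional_calculus n g b) w"
    if w: "w \<in> carrier_vec n" for w
  proof -
    have rw: "r' *\<^sub>v w \<in> carrier_vec n" using C w by (simp add: mult_vec)
    \<comment> \<open>The product \<open>c r'\<close> acts as \<open>s'\<close>, so testing at
      \<open>r' w\<close> conjugates f(a) by \<open>r'\<close> and f(b) by \<open>s'\<close>. Each
      inverse root enters twice, which divides f(t) by t.\<close>
    have "c *\<^sub>v (r' *\<^sub>v w) = s' *\<^sub>v ((r * r') *\<^sub>v w)"
      using C w by (simp add: c_def assoc_vec mult mult_vec)
    then have crw: "c *\<^sub>v (r' *\<^sub>v w) = s' *\<^sub>v w"
      using w by (simp add: rr')
    have "quad_form (functional_calculus n f a) (r' *\<^sub>v w)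
        \<le> quad_form (mat_adjoint c * functional_calculus n f b * c) (r' *\<^sub>v w)"
      using L rw loewner_le_iff unfolding loewner_le_def by blast
    also have "\<dots> = quad_form (functional_calculus n f b) (s' *\<^sub>v w)"
      using quad_form_conj[OF cC _ rw, of "functional_calculus n f b"] vC by (simp add: crw fb)
    also have "\<dots> = quad_form (functional_calculus n g b) w"
      unfolding fb gb s'_def quad_form_diag_conj_sandwich[OF v w]
      by (intro arg_cong2[where f = quad_form] diag_conj_cong[OF vC] scale e refl)
    also have "quad_form (functional_calculus n f a) (r' *\<^sub>v w) = quad_form (functional_calculus n g a) w"
      unfolding fa ga r'_def quad_form_diag_conj_sandwich[OF u w]
      by (intro arg_cong2[where f = quad_form] diag_conj_cong[OF uC] scale d refl)
    finally show ?thesis .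
  qed
  then show "loewner_le n (functional_calculus n g a) (functional_calculus n g b)"
    using loewner_le_iff[of "functional_calculus n g a" "functional_calculus n g b"] u v
    by (simp add: ga gb selfadjoint_mat_diag_conj)
qed

text \<open>The shift by \<open>s\<close> keeps the spectra inside the domain of \<open>g\<close> even if \<open>c\<close> is not invertible.\<close>

lemma n_monotone_shifted_contraction_inequality:
  assumes g: "n_monotone n I g" and I: "{s..M + s} \<subseteq> I"
    and u: "unitary_mat n u" and d: "\<And>i. i < n \<Longrightarrow> d i \<in> {0..M}" and M: "0 \<le> M"
    and c: "contraction_mat n c" and v: "unitary_mat n v"
    and eq: "mat_adjoint c * diag_conj n u d * c = diag_conj n v e"
    and w: "w \<in> carrier_vec n"
  shows "quad_form (diag_conj n v (\<lambda>i. e i * g (e i + s))) w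
    \<le> quad_form (diag_conj n u (\<lambda>i. d i * g (d i + s))) (c *\<^sub>v w)"
proof -
  have C: "c \<in> carrier_mat n n" "u \<in> carrier_mat n n" "v \<in> carrier_mat n n"
    using c u v by (auto simp: contraction_mat_iff unitary_mat_def)
  define r where "r = diag_conj n u (\<lambda>i. sqrt (d i))"
  have r: "r \<in> carrier_mat n n" "mat_adjoint r = r" using C by (auto simp: r_def)
  have rr: "r * r = diag_conj n u d"
    unfolding r_def diag_conj_mult[OF u] using d by (intro diag_conj_cong[OF C(2)]) auto
  define x where "x = r * c"
  have x: "x \<in> carrier_mat n n" using C r by (simp add: x_def mult)
  have adj_x: "mat_adjoint x = mat_adjoint c * r" using C r by (simp add: x_def adj_mult)
  have xx: "mat_adjoint x * x = diag_conj n v e"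
  proof -
    have "mat_adjoint x * x = mat_adjoint c * (r * r) * c"
      using C r by (simp add: adj_x) (simp add: x_def assoc mult)
    then show ?thesis by (simp add: rr eq)
  qed
  have "selfadjoint_mat n (x * mat_adjoint x)"
    using x by (simp add: selfadjoint_mat_def adj_mult mult)
  then obtain z h where z: "unitary_mat n z" and xx': "x * mat_adjoint x = diag_conj n z h"
    by (rule selfadjoint_mat_diagonalizes)
  have zC: "z \<in> carrier_mat n n" using z by (simp add: unitary_mat_def)
  \<comment> \<open>The form of \<open>x x\<^sup>*\<close> at \<open>p\<close> is the squared length
    of \<open>c\<^sup>* r p\<close>, so the upper bound rests on \<open>c\<^sup>*\<close> being a
    contraction.\<close>
  have y: "0 \<le> quad_form (diag_conj n z h) p"
    "quad_form (diag_conj n z h) p \<le> quad_form (diag_conj n u d) p" if p: "p \<in> carrier_vec n" for p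
  proof -
    have rp: "r *\<^sub>v p \<in> carrier_vec n" using r p by (simp add: mult_vec)
    have q: "quad_form (diag_conj n z h) p = quad_form (1\<^sub>m n) (mat_adjoint x *\<^sub>v p)"
      using quad_form_adjoint_mult[of "mat_adjoint x" p] x p by (simp add: xx')
    show "0 \<le> quad_form (diag_conj n z h) p"
      unfolding q using x p by (intro quad_form_one_nonneg) (simp add: mult_vec)
    have "quad_form (1\<^sub>m n) (mat_adjoint x *\<^sub>v p) = quad_form (1\<^sub>m n) (mat_adjoint c *\<^sub>v (r *\<^sub>v p))"
      using C r p by (simp add: adj_x assoc_vec)
    also have "\<dots> \<le> quad_form (1\<^sub>m n) (r *\<^sub>v p)"
      using contraction_mat_adjoint[OF c] rp by (simp add: contraction_mat_iff)
    also have "\<dots> = quad_form (diag_conj n u d) p"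
      using quad_form_adjoint_mult[OF r(1) p] by (simp add: r rr)
    finally show "quad_form (diag_conj n z h) p \<le> quad_form (diag_conj n u d) p"
      by (simp add: q)
  qed
  have h: "h i \<in> {0..M}" if "i < n" for i
  proof (rule diag_conj_eigenvalue_bounds[OF z that y(1)])
    fix p :: "complex vec" assume p: "p \<in> carrier_vec n"
    show "quad_form (diag_conj n z h) p \<le> M * quad_form (1\<^sub>m n) p"
      using y(2)[OF p] quad_form_diag_conj_bounds(2)[OF u p, of d M] d by simp
  qed
  \<comment> \<open>Both matrices gain the same multiple of the identity, which keeps their order
    and moves both spectra from \<open>{0..M}\<close> into \<open>I\<close>.\<close>
  have "loewner_le n (diag_conj n z (\<lambda>i. h i + s)) (diag_conj n u (\<lambda>i. d i + s))"
    using y(2) by (simp add: loewner_le_iff selfadjoint_mat_diag_conj z u quad_form_diag_conj_add_const)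
  moreover have "spectrum_in (diag_conj n z (\<lambda>i. h i + s)) I" "spectrum_in (diag_conj n u (\<lambda>i. d i + s)) I"
    using h d I by (auto simp: spectrum_in_diag_conj z u subset_iff)
  ultimately have L: "loewner_le n (diag_conj n z (\<lambda>i. g (h i + s))) (diag_conj n u (\<lambda>i. g (d i + s)))"
    using g[unfolded n_monotone_def, rule_format, of "diag_conj n z (\<lambda>i. h i + s)"
        "diag_conj n u (\<lambda>i. d i + s)"]
    by (simp add: functional_calculus_diag_conj selfadjoint_mat_diag_conj z u)
  have cw: "c *\<^sub>v w \<in> carrier_vec n" and xw: "x *\<^sub>v w \<in> carrier_vec n"
    using C x w by (auto simp: mult_vec)
  \<comment> \<open>Both sides are \<open>x x\<^sup>* x\<close>; this is all that is needed to move
    a function past \<open>x\<close>.\<close>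
  have "x * diag_conj n v e = diag_conj n z h * x"
    using x by (simp add: assoc mult flip: xx xx')
  then have inter: "x * diag_conj n v (\<lambda>i. g (e i + s)) = diag_conj n z (\<lambda>i. g (h i + s)) * x"
    by (rule diag_conj_intertwine[OF v z x])
  \<comment> \<open>Once \<open>g\<close> has moved past \<open>x\<close>, the factor
    \<open>x\<^sup>* x\<close> left over contributes \<open>e i\<close> in front of
    \<open>g (e i + s)\<close>.\<close>
  have "mat_adjoint x * diag_conj n z (\<lambda>i. g (h i + s)) * x
      = mat_adjoint x * x * diag_conj n v (\<lambda>i. g (e i + s))"
    using x zC C by (simp add: assoc mult inter)
  also have "\<dots> = diag_conj n v (\<lambda>i. e i * g (e i + s))"
    by (simp add: xx diag_conj_mult v)
  finally have "quad_form (diag_conj n v (\<lambda>i. e i * g (e i + s))) w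
      = quad_form (diag_conj n z (\<lambda>i. g (h i + s))) (x *\<^sub>v w)"
    using quad_form_conj[OF x diag_conj_carrier[OF zC, of "\<lambda>i. g (h i + s)"] w] by simp
  also have "\<dots> \<le> quad_form (diag_conj n u (\<lambda>i. g (d i + s))) (x *\<^sub>v w)"
    using L xw by (simp add: loewner_le_iff selfadjoint_mat_diag_conj z u)
  also have "x *\<^sub>v w = r *\<^sub>v (c *\<^sub>v w)"
    using C r w by (simp add: x_def assoc_vec)
  also have "quad_form (diag_conj n u (\<lambda>i. g (d i + s))) (r *\<^sub>v (c *\<^sub>v w))
      = quad_form (diag_conj n u (\<lambda>i. d i * g (d i + s))) (c *\<^sub>v w)"
    unfolding r_def quad_form_diag_conj_sandwich[OF u cw]
    using d by (intro arg_cong2[where f = quad_form] diag_conj_cong[OF C(2)]) (auto simp: mult.commute mult.left_commute)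
  finally show ?thesis .
qed

text \<open>Numbers embed as scalar matrices, compatibly with order and functional calculus;
  \<open>0 < n\<close> provides a diagonal entry to read off.\<close>

lemma n_monotone_imp_mono:
  assumes g: "n_monotone n I g" and n: "0 < n" and st: "s \<in> I" "t \<in> I" "s \<le> t"
  shows "g s \<le> g t"
proof -
  note U = unitary_mat_one
  obtain v where v: "v \<in> carrier_vec n" "\<And>d. quad_form (diag_conj n (1\<^sub>m n) d) v = d 0"
    using diag_conj_eigenvector[OF U n] by metis
  have "loewner_le n (diag_conj n (1\<^sub>m n) (\<lambda>_. s)) (diag_conj n (1\<^sub>m n) (\<lambda>_. t))"
    using st by (simp add: loewner_le_iff selfadjoint_mat_diag_conj U quad_form_diag_conj_mono)
  moreover have "spectrum_in (diag_conj n (1\<^sub>m n) (\<lambda>_. s)) I" "spectrum_in (diag_conj n (1\<^sub>m n) (\<lambda>_. t)) I"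
    using st by (auto simp: spectrum_in_diag_conj U)
  ultimately have "loewner_le n (diag_conj n (1\<^sub>m n) (\<lambda>_. g s)) (diag_conj n (1\<^sub>m n) (\<lambda>_. g t))"
    using g[unfolded n_monotone_def, rule_format, of "diag_conj n (1\<^sub>m n) (\<lambda>_. s)"
        "diag_conj n (1\<^sub>m n) (\<lambda>_. t)"]
    by (simp add: functional_calculus_diag_conj selfadjoint_mat_diag_conj U)
  then have "quad_form (diag_conj n (1\<^sub>m n) (\<lambda>_. g s)) v \<le> quad_form (diag_conj n (1\<^sub>m n) (\<lambda>_. g t)) v"
    using v(1) by (simp add: loewner_le_iff selfadjoint_mat_diag_conj U)
  then show ?thesis
    by (simp only: v(2))
qed

section \<open>Limits\<close>

lemma pow_mat_diag_conj:
  assumes u: "unitary_mat n u"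
  shows "diag_conj n u d ^\<^sub>m k = diag_conj n u (\<lambda>i. d i ^ k)"
proof (induction k)
  case 0
  show ?case
    using u diag_conj_one[OF u, of "\<lambda>_. 1"] by (auto simp: unitary_mat_def)
next
  case (Suc k)
  then show ?case by (simp add: diag_conj_mult[OF u] mult.commute)
qed

text \<open>The right-hand side refers to powers of the matrix and not to its diagonalization, so it
  is continuous in the entries even where eigenvectors jump.\<close>

lemma quad_form_diag_conj_polynomial:
  assumes u: "unitary_mat n u" and v: "v \<in> carrier_vec n"
  shows "quad_form (diag_conj n u (\<lambda>i. \<Sum>k\<le>N. c k * d i ^ k)) v
    = (\<Sum>k\<le>N. c k * quad_form (diag_conj n u d ^\<^sub>m k) v)"
proof -
  have uC: "u \<in> carrier_mat n n" using u by (simp add: unitary_mat_def)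
  show ?thesis
    unfolding pow_mat_diag_conj[OF u] quad_form_diag_conj[OF uC v] sum_distrib_left sum_distrib_right
    by (subst sum.swap) (simp add: mult.assoc)
qed

lemma mat_mult_tendsto:
  fixes X Y :: "'b \<Rightarrow> complex mat"
  assumes "\<And>s. X s \<in> carrier_mat n n" "\<And>s. Y s \<in> carrier_mat n n"
    and "a \<in> carrier_mat n n" "b \<in> carrier_mat n n"
    and "\<And>i j. i < n \<Longrightarrow> j < n \<Longrightarrow> ((\<lambda>s. X s $$ (i, j)) \<longlongrightarrow> a $$ (i, j)) F"
    and "\<And>i j. i < n \<Longrightarrow> j < n \<Longrightarrow> ((\<lambda>s. Y s $$ (i, j)) \<longlongrightarrow> b $$ (i, j)) F"
    and ij: "i < n" "j < n"
  shows "((\<lambda>s. (X s * Y s) $$ (i, j)) \<longlongrightarrow> (a * b) $$ (i, j)) F"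
proof -
  have eq: "(A * B) $$ (i, j) = (\<Sum>l<n. A $$ (i, l) * B $$ (l, j))"
    if "A \<in> carrier_mat n n" "B \<in> carrier_mat n n" for A B :: "complex mat"
    using that ij by (simp add: scalar_prod_def atLeast0LessThan)
  show ?thesis
    unfolding eq[OF assms(1,2)] eq[OF assms(3,4)]
    using assms by (intro tendsto_sum tendsto_mult) auto
qed

lemma pow_mat_tendsto:
  fixes X :: "'b \<Rightarrow> complex mat"
  assumes X: "\<And>s. X s \<in> carrier_mat n n" and a: "a \<in> carrier_mat n n"
    and lim: "\<And>i j. i < n \<Longrightarrow> j < n \<Longrightarrow> ((\<lambda>s. X s $$ (i, j)) \<longlongrightarrow> a $$ (i, j)) F"
    and ij: "i < n" "j < n"
  shows "((\<lambda>s. (X s ^\<^sub>m k) $$ (i, j)) \<longlongrightarrow> (a ^\<^sub>m k) $$ (i, j)) F"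
  using ij
proof (induction k arbitrary: i j)
  case 0
  then show ?case using carrier_matD[OF X] a by simp
next
  case (Suc k)
  show ?case
    unfolding pow_mat.simps
    using X a lim Suc by (intro mat_mult_tendsto) auto
qed

lemma quad_form_tendsto:
  fixes X :: "'b \<Rightarrow> complex mat"
  assumes X: "\<And>s. X s \<in> carrier_mat n n" and a: "a \<in> carrier_mat n n"
    and lim: "\<And>i j. i < n \<Longrightarrow> j < n \<Longrightarrow> ((\<lambda>s. X s $$ (i, j)) \<longlongrightarrow> a $$ (i, j)) F"
    and v: "v \<in> carrier_vec n"
  shows "((\<lambda>s. quad_form (X s) v) \<longlongrightarrow> quad_form a v) F"
proof -
  have eq: "quad_form A v = Re (\<Sum>i<n. (\<Sum>j<n. A $$ (i, j) * v $ j) * cnj (v $ i))"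
    if "A \<in> carrier_mat n n" for A
    using that v by (simp add: quad_form_def scalar_prod_def atLeast0LessThan)
  show ?thesis
    unfolding eq[OF X] eq[OF a] using lim by (intro tendsto_intros) auto
qed

end

text \<open>The domain is open at its upper end, so a finite \<open>m\<close> below \<alpha> leaves
  room for small positive \<open>s\<close>, also when \<alpha> is infinite.\<close>

lemma shift_tendsto:
  fixes f :: "real \<Rightarrow> real"
  assumes f: "continuous_on {t. 0 \<le> t \<and> ereal t < \<alpha>} f" and t: "0 \<le> t" "ereal t < \<alpha>"
  shows "((\<lambda>s. f (t + s)) \<longlongrightarrow> f t) (at_right 0)"
proof -
  obtain m where m: "t < m" "ereal m < \<alpha>"
    using ereal_dense2[OF t(2)] by auto
  have "\<forall>\<^sub>F s in at_right 0. s \<in> {0<..<m - t}"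
    using m by (intro eventually_at_right_real) simp
  then have "\<forall>\<^sub>F s in at_right 0. t + s \<in> {t. 0 \<le> t \<and> ereal t < \<alpha>}"
  proof eventually_elim
    case (elim s)
    then have "ereal (t + s) \<le> ereal m" by simp
    then have "ereal (t + s) < \<alpha>" using m(2) by (rule le_less_trans)
    then show ?case using elim t by simp
  qed
  moreover have "((\<lambda>s. t + s) \<longlongrightarrow> t) (at_right 0)"
    using tendsto_add[OF tendsto_const[of t] tendsto_ident_at[of 0 "{0<..}"]] by simp
  ultimately show ?thesis
    using continuous_on_tendsto_compose[OF f, of "\<lambda>s. t + s" t "at_right 0"] t by simp
qed

lemma finite_upper_bound_ereal:
  fixes d :: "nat \<Rightarrow> real"
  assumes "0 < \<alpha>" "\<And>i. i < n \<Longrightarrow> ereal (d i) < \<alpha>"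
  obtains M where "0 \<le> M" "ereal M < \<alpha>" "\<And>i. i < n \<Longrightarrow> d i \<le> M"
proof
  \<comment> \<open>Inserting 0 keeps the maximum meaningful for \<open>n = 0\<close> and makes it
    nonnegative.\<close>
  let ?M = "Max (insert 0 (d ` {..<n}))"
  show "0 \<le> ?M" "\<And>i. i < n \<Longrightarrow> d i \<le> ?M" by auto
  have "?M \<in> insert 0 (d ` {..<n})" by (rule Max_in) auto
  then show "ereal ?M < \<alpha>" using assms by (auto simp: zero_ereal_def)
qed

section \<open>From monotonicity of the quotient to the contraction inequality\<close>

context
  fixes n :: nat and \<alpha> :: ereal and f g :: "real \<Rightarrow> real"
  assumes f: "continuous_on {t. 0 \<le> t \<and> ereal t < \<alpha>} f"
    and g: "\<And>t. 0 < t \<Longrightarrow> ereal t < \<alpha> \<Longrightarrow> g t = f t / t"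
    and mono: "n_monotone n {t. 0 < t \<and> ereal t < \<alpha>} g"
begin

text \<open>Monotonicity compares g(s) with a fixed g(m), hence f(s) = s g(s) <= s g(m) for small s,
  and this bound tends to 0.\<close>

lemma n_monotone_quotient_zero:
  assumes \<alpha>: "0 < \<alpha>" and n: "0 < n"
  shows "f 0 \<le> 0"
proof -
  obtain m where m: "0 < m" "ereal m < \<alpha>"
    using ereal_dense2[OF \<alpha>] by (auto simp: zero_ereal_def)
  have "((\<lambda>s. f (0 + s)) \<longlongrightarrow> f 0) (at_right 0)"
    using \<alpha> by (intro shift_tendsto[OF f]) (auto simp: zero_ereal_def)
  then have lim: "(f \<longlongrightarrow> f 0) (at_right 0)" by simp
  have lim': "((\<lambda>s. s * g m) \<longlongrightarrow> 0 * g m) (at_right 0)"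
    by (intro tendsto_intros)
  have "\<forall>\<^sub>F s in at_right 0. s \<in> {0<..<m}"
    using m(1) by (rule eventually_at_right_real)
  then have "\<forall>\<^sub>F s in at_right 0. f s \<le> s * g m"
  proof eventually_elim
    case (elim s)
    then have "ereal s \<le> ereal m" by simp
    then have s: "ereal s < \<alpha>" using m(2) by (rule le_less_trans)
    have "g s \<le> g m"
      using elim s m by (intro n_monotone_imp_mono[OF mono n]) auto
    then show ?case using elim s by (simp add: g field_simps)
  qed
  from tendsto_le[OF _ lim' lim this] show ?thesis by simp
qed

text \<open>The limit of the shifted inequality as the shift tends to 0. Since every
  \<open>d i\<close> is positive, the larger side tends to the wanted form. Some \<open>e i\<close>
  may be 0 when \<open>c\<close> is singular, and there the limit 0 still dominates
  \<open>f 0\<close>.\<close>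

lemma contraction_inequality_positive:
  assumes u: "unitary_mat n u" and d: "\<And>i. i < n \<Longrightarrow> 0 < d i \<and> d i \<le> M"
    and M: "0 \<le> M" "ereal M < \<alpha>"
    and c: "contraction_mat n c" and v: "unitary_mat n v"
    and eq: "mat_adjoint c * diag_conj n u d * c = diag_conj n v e"
    and w: "w \<in> carrier_vec n"
  shows "quad_form (diag_conj n v (\<lambda>i. f (e i))) w
    \<le> quad_form (diag_conj n u (\<lambda>i. f (d i))) (c *\<^sub>v w)"
proof -
  have C: "c \<in> carrier_mat n n" "u \<in> carrier_mat n n" "v \<in> carrier_mat n n"
    using c u v by (auto simp: contraction_mat_iff unitary_mat_def)
  have cw: "c *\<^sub>v w \<in> carrier_vec n"
    using C w by (simp add: mult_mat_vec_carrier[of _ n n])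
  have \<alpha>: "0 < \<alpha>"
    using M le_less_trans[of 0 "ereal M" \<alpha>] by (simp add: zero_ereal_def)
  have d': "d i \<in> {0..M}" if "i < n" for i using d[OF that] by simp
  have e: "e i \<in> {0..M}" if "i < n" for i
    using contraction_conj_eigenvalue_bounds[OF u c v eq d' M(1) that] .
  \<comment> \<open>Room above \<open>M\<close>: for \<open>s < m - M\<close> the interval
    \<open>{s..M + s}\<close> stays below \<alpha>.\<close>
  obtain m where m: "M < m" "ereal m < \<alpha>"
    using ereal_dense2[OF M(2)] by auto
  have lt: "ereal t < \<alpha>" if "t \<le> M" for t
    using that M(2) le_less_trans[of "ereal t" "ereal M"] by simp
  have lim: "((\<lambda>s. t * g (t + s)) \<longlongrightarrow> f t) (at_right 0)" if t: "0 < t" "t \<le> M" for t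
  proof -
    have "((\<lambda>s. t * (f (t + s) / (t + s))) \<longlongrightarrow> t * (f t / (t + 0))) (at_right 0)"
      using t lt by (intro tendsto_intros shift_tendsto[OF f]) auto
    moreover have "\<forall>\<^sub>F s in at_right 0. s \<in> {0<..<m - t}"
      using m t by (intro eventually_at_right_real) auto
    then have "\<forall>\<^sub>F s in at_right 0. t * (f (t + s) / (t + s)) = t * g (t + s)"
    proof eventually_elim
      case (elim s)
      then have "ereal (t + s) \<le> ereal m" by simp
      then have "ereal (t + s) < \<alpha>" using m(2) by (rule le_less_trans)
      then show ?case using elim t by (subst g) auto
    qed
    ultimately show ?thesis
      using t by (simp add: tendsto_cong)
  qed
  \<comment> \<open>The pointwise limit of \<open>t * g (t + s)\<close> on \<open>{0..M}\<close>: at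
    \<open>t = 0\<close> the product is 0 for every \<open>s\<close>.\<close>
  define f0 where "f0 t = (if t = 0 then 0 else f t)" for t
  have "((\<lambda>s. quad_form (diag_conj n v (\<lambda>i. e i * g (e i + s))) w)
      \<longlongrightarrow> quad_form (diag_conj n v (\<lambda>i. f0 (e i))) w) (at_right 0)"
    using e lim by (intro quad_form_diag_conj_tendsto C w) (auto simp: f0_def order_le_less)
  moreover have "((\<lambda>s. quad_form (diag_conj n u (\<lambda>i. d i * g (d i + s))) (c *\<^sub>v w))
      \<longlongrightarrow> quad_form (diag_conj n u (\<lambda>i. f (d i))) (c *\<^sub>v w)) (at_right 0)"
    using d lim by (intro quad_form_diag_conj_tendsto C cw) auto
  moreover have "\<forall>\<^sub>F s in at_right 0. s \<in> {0<..<m - M}"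
    using m by (intro eventually_at_right_real) auto
  then have "\<forall>\<^sub>F s in at_right 0. quad_form (diag_conj n v (\<lambda>i. e i * g (e i + s))) w
      \<le> quad_form (diag_conj n u (\<lambda>i. d i * g (d i + s))) (c *\<^sub>v w)"
  proof eventually_elim
    case (elim s)
    have "{s..M + s} \<subseteq> {t. 0 < t \<and> ereal t < \<alpha>}"
    proof clarsimp
      fix t assume t: "s \<le> t" "t \<le> M + s"
      then have "ereal t \<le> ereal m" using elim by simp
      then have "ereal t < \<alpha>" using m(2) by (rule le_less_trans)
      then show "0 < t \<and> ereal t < \<alpha>" using t elim by simp
    qed
    then show ?case
      using n_monotone_shifted_contraction_inequality[OF mono _ u d' M(1) c v eq w] by blast
  qed
  ultimately have "quad_form (diag_conj n v (\<lambda>i. f0 (e i))) w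
      \<le> quad_form (diag_conj n u (\<lambda>i. f (d i))) (c *\<^sub>v w)"
    by (intro tendsto_le[OF _ _ _]) auto
  moreover have "quad_form (diag_conj n v (\<lambda>i. f (e i))) w \<le> quad_form (diag_conj n v (\<lambda>i. f0 (e i))) w"
    using n_monotone_quotient_zero[OF \<alpha>] by (intro quad_form_diag_conj_mono C w) (auto simp: f0_def)
  ultimately show ?thesis by linarith
qed

text \<open>Passing from \<open>a + s\<close> to \<open>a\<close>: the matrices \<open>c\<^sup>* (a + s) c\<close> need not commute, so \<open>f\<close> is
  replaced by a uniformly close polynomial, whose functional calculus is continuous.\<close>

lemma contraction_inequality_diag_conj:
  assumes u: "unitary_mat n u" and d: "\<And>i. i < n \<Longrightarrow> d i \<in> {0..M}"
    and M: "0 \<le> M" "ereal M < \<alpha>"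
    and c: "contraction_mat n c" and v: "unitary_mat n v"
    and eq: "mat_adjoint c * diag_conj n u d * c = diag_conj n v e"
    and w: "w \<in> carrier_vec n"
  shows "quad_form (diag_conj n v (\<lambda>i. f (e i))) w
    \<le> quad_form (diag_conj n u (\<lambda>i. f (d i))) (c *\<^sub>v w)" (is "?lhs \<le> ?rhs")
proof -
  have C: "c \<in> carrier_mat n n" "u \<in> carrier_mat n n" "v \<in> carrier_mat n n"
    using c u v by (auto simp: contraction_mat_iff unitary_mat_def)
  have cw: "c *\<^sub>v w \<in> carrier_vec n"
    using C w by (simp add: mult_mat_vec_carrier[of _ n n])
  have e: "e i \<in> {0..M}" if "i < n" for i
    using contraction_conj_eigenvalue_bounds[OF u c v eq d M(1) that] .
  obtain m where m: "M < m" "ereal m < \<alpha>"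
    using ereal_dense2[OF M(2)] by auto
  have lt: "ereal t < \<alpha>" if "t \<le> m" for t
    using that m(2) le_less_trans[of "ereal t" "ereal m"] by simp
  have d_lt: "ereal (d i) < \<alpha>" if "i < n" for i
    using d[OF that] m lt[of "d i"] by simp
  define N where "N = quad_form (1\<^sub>m n) w"
  \<comment> \<open>For \<open>s > 0\<close> the middle matrix has positive eigenvalues, so the
    inequality for positive \<open>d\<close> applies to \<open>B s\<close>; the matrix of interest
    is \<open>B 0\<close>.\<close>
  define B where "B s = mat_adjoint c * diag_conj n u (\<lambda>i. d i + s) * c" for s
  have B: "B s \<in> carrier_mat n n" for s
    using C by (simp add: B_def mult_carrier_mat[where nr = n and n = n and nc = n])
  have B0: "B 0 = diag_conj n v e" by (simp add: B_def eq)
  have B_lim: "((\<lambda>s. B s $$ (i, j)) \<longlongrightarrow> B 0 $$ (i, j)) (at_right 0)" if "i < n" "j < n" for i j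
    unfolding B_def
  proof (rule mat_mult_tendsto[OF _ _ _ _ _ _ that])
    fix i j assume ij: "i < n" "j < n"
    have "((\<lambda>s. diag_conj n u (\<lambda>i. d i + s) $$ (i, j)) \<longlongrightarrow> diag_conj n u (\<lambda>i. d i + 0) $$ (i, j)) (at_right 0)"
      if "i < n" "j < n" for i j
      unfolding diag_conj_index[OF C(2) that] by (intro tendsto_intros)
    then show "((\<lambda>s. (mat_adjoint c * diag_conj n u (\<lambda>i. d i + s)) $$ (i, j))
        \<longlongrightarrow> (mat_adjoint c * diag_conj n u (\<lambda>i. d i + 0)) $$ (i, j)) (at_right 0)"
      using C ij by (intro mat_mult_tendsto) auto
  qed (use C in \<open>auto simp: mult_carrier_mat[where nr = n and n = n and nc = n]\<close>)
  \<comment> \<open>One error \<open>r * N\<close> comes from passing from the polynomial to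
    \<open>f\<close> at \<open>B s\<close>, the other from passing from \<open>f\<close> to the
    polynomial at \<open>B 0\<close>.\<close>
  have approx: "?lhs \<le> ?rhs + 2 * r * N" if r: "0 < r" for r
  proof -
    \<comment> \<open>The interval reaches up to \<open>m\<close> so that one polynomial serves the
      spectra of all \<open>B s\<close> with \<open>s < m - M\<close>.\<close>
    have "continuous_on {0..m} f"
      using f by (rule continuous_on_subset) (auto simp: lt)
    then obtain p where p: "real_polynomial_function p" and fp: "\<And>t. t \<in> {0..m} \<Longrightarrow> \<bar>f t - p t\<bar> < r"
      using Stone_Weierstrass_real_polynomial_function[of "{0..m}" f r] r by auto
    then obtain b L where p_eq: "p = (\<lambda>t. \<Sum>k\<le>L. b k * t ^ k)"
      using real_polynomial_function_iff_sum by metis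
    define P where "P A = (\<Sum>k\<le>L. b k * quad_form (A ^\<^sub>m k) w)" for A
    have P: "P (diag_conj n z h) = quad_form (diag_conj n z (\<lambda>i. p (h i))) w"
      if "unitary_mat n z" for z h
      unfolding P_def p_eq using quad_form_diag_conj_polynomial[OF that w] by simp
    have "((\<lambda>s. P (B s)) \<longlongrightarrow> P (B 0)) (at_right 0)"
      unfolding P_def using B B_lim w
      by (intro tendsto_intros quad_form_tendsto pow_mat_tendsto) auto
    moreover have "((\<lambda>s. quad_form (diag_conj n u (\<lambda>i. f (d i + s))) (c *\<^sub>v w) + r * N)
        \<longlongrightarrow> ?rhs + r * N) (at_right 0)"
      using d d_lt by (intro tendsto_add tendsto_const quad_form_diag_conj_tendsto C cw shift_tendsto[OF f]) auto
    moreover have "\<forall>\<^sub>F s in at_right 0. s \<in> {0<..<m - M}"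
      using m by (intro eventually_at_right_real) auto
    then have "\<forall>\<^sub>F s in at_right 0. P (B s)
        \<le> quad_form (diag_conj n u (\<lambda>i. f (d i + s))) (c *\<^sub>v w) + r * N"
    proof eventually_elim
      case (elim s)
      have "selfadjoint_mat n (B s)"
        unfolding B_def by (intro selfadjoint_mat_conj selfadjoint_mat_diag_conj u C)
      then obtain z h where z: "unitary_mat n z" and h: "B s = diag_conj n z h"
        by (rule selfadjoint_mat_diagonalizes)
      have d_s: "0 < d i + s \<and> d i + s \<le> m" if "i < n" for i
        using d[OF that] elim by auto
      have m0: "0 \<le> m" using M m by simp
      have h_m: "h i \<in> {0..m}" if "i < n" for i
        using contraction_conj_eigenvalue_bounds[OF u c z h[unfolded B_def] _ m0 that] d_s
        by (simp add: less_imp_le)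
      have "P (B s) \<le> quad_form (diag_conj n z (\<lambda>i. f (h i))) w + r * N"
        unfolding h P[OF z] N_def
        using fp h_m by (intro quad_form_diag_conj_le z w) (smt (verit))
      also have "quad_form (diag_conj n z (\<lambda>i. f (h i))) w
          \<le> quad_form (diag_conj n u (\<lambda>i. f (d i + s))) (c *\<^sub>v w)"
        using contraction_inequality_positive[OF u d_s m0 m(2) c z h[unfolded B_def] w] .
      finally show ?case by simp
    qed
    ultimately have "P (B 0) \<le> ?rhs + r * N"
      by (intro tendsto_le[OF _ _ _]) auto
    moreover have "?lhs \<le> P (B 0) + r * N"
      unfolding B0 P[OF v] N_def
    proof (intro quad_form_diag_conj_le v w)
      fix i assume "i < n"
      then have "e i \<in> {0..m}" using e m by force
      then show "f (e i) \<le> p (e i) + r" using fp by (smt (verit))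
    qed
    ultimately show ?thesis by simp
  qed
  have "((\<lambda>r. ?rhs + 2 * r * N) \<longlongrightarrow> ?rhs + 2 * 0 * N) (at_right 0)"
    by (intro tendsto_intros)
  moreover have "\<forall>\<^sub>F r in at_right 0. ?lhs \<le> ?rhs + 2 * r * N"
    using eventually_at_right_less[of "0 :: real"] by eventually_elim (rule approx)
  ultimately show ?thesis
    using tendsto_lowerbound[of _ _ "at_right (0 :: real)" ?lhs] by fastforce
qed

text \<open>The finitely many eigenvalues of \<open>a\<close> have a common bound \<open>M\<close>
  below \<alpha>, so the half-open domain can be replaced by a compact interval before the
  diagonalized inequality is applied.\<close>

lemma contraction_inequality_if_n_monotone:
  assumes \<alpha>: "0 < \<alpha>" and a: "psd_mat n a" "spectrum_in a {t. 0 \<le> t \<and> ereal t < \<alpha>}"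
    and c: "contraction_mat n c"
  shows "loewner_le n (functional_calculus n f (mat_adjoint c * a * c))
    (mat_adjoint c * functional_calculus n f a * c)"
proof -
  have C: "c \<in> carrier_mat n n" using c by (simp add: contraction_mat_iff)
  have sa: "selfadjoint_mat n a" using a by (simp add: psd_mat_def)
  obtain u d where u: "unitary_mat n u" and a_eq: "a = diag_conj n u d"
    using selfadjoint_mat_diagonalizes[OF sa] .
  obtain v e where v: "unitary_mat n v" and b_eq: "mat_adjoint c * a * c = diag_conj n v e"
    using selfadjoint_mat_diagonalizes[OF selfadjoint_mat_conj[OF sa C]] .
  have d: "0 \<le> d i" "ereal (d i) < \<alpha>" if "i < n" for i
    using a(2) that by (auto simp: a_eq spectrum_in_diag_conj u)
  obtain M where M: "0 \<le> M" "ereal M < \<alpha>" "\<And>i. i < n \<Longrightarrow> d i \<le> M"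
    using finite_upper_bound_ereal[OF \<alpha>, of n d] d(2) by auto
  have fa: "functional_calculus n f a = diag_conj n u (\<lambda>i. f (d i))"
    by (simp add: a_eq functional_calculus_diag_conj u)
  have fb: "functional_calculus n f (mat_adjoint c * a * c) = diag_conj n v (\<lambda>i. f (e i))"
    by (simp add: b_eq functional_calculus_diag_conj v)
  have "quad_form (diag_conj n v (\<lambda>i. f (e i))) w
      \<le> quad_form (mat_adjoint c * diag_conj n u (\<lambda>i. f (d i)) * c) w" if w: "w \<in> carrier_vec n" for w
    using contraction_inequality_diag_conj[OF u _ M(1,2) c v b_eq[unfolded a_eq] w] d M(3)
      quad_form_conj[OF C _ w] u
    by (simp add: unitary_mat_def)
  then show ?thesis
    unfolding fa fb
    by (simp add: loewner_le_iff selfadjoint_mat_conj selfadjoint_mat_diag_conj u v C)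
qed

end

theorem theorem3p1:
  fixes n :: nat and \<alpha> :: ereal and f g :: "real \<Rightarrow> real"
  assumes "0 < \<alpha>"
    and "continuous_on {t. 0 \<le> t \<and> ereal t < \<alpha>} f"
    and "\<And>t. 0 < t \<Longrightarrow> ereal t < \<alpha> \<Longrightarrow> g t = f t / t"
  shows "(\<forall>a c. psd_mat n a \<longrightarrow> spectrum_in a {t. 0 \<le> t \<and> ereal t < \<alpha>} \<longrightarrow>
            contraction_mat n c \<longrightarrow>
            loewner_le n (functional_calculus n f (mat_adjoint c * a * c))
              (mat_adjoint c * functional_calculus n f a * c))
         \<longleftrightarrow> n_monotone n {t. 0 < t \<and> ereal t < \<alpha>} g"
proof
  have "{t. 0 < t \<and> ereal t < \<alpha>} = {t. 0 \<le> t \<and> ereal t < \<alpha>} \<inter> {0<..}"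
    by auto
  then show "n_monotone n {t. 0 < t \<and> ereal t < \<alpha>} g"
    if "\<forall>a c. psd_mat n a \<longrightarrow> spectrum_in a {t. 0 \<le> t \<and> ereal t < \<alpha>} \<longrightarrow>
            contraction_mat n c \<longrightarrow>
            loewner_le n (functional_calculus n f (mat_adjoint c * a * c))
              (mat_adjoint c * functional_calculus n f a * c)"
    using that assms(3) n_monotone_if_contraction_inequality[of n "{t. 0 \<le> t \<and> ereal t < \<alpha>}" f g]
    by simp
qed (use contraction_inequality_if_n_monotone[OF assms(2,3) _ assms(1)] in blast)

end
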